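(* Let $k>0$ and $n\in\mathbb{Z}$. For all $x,y\in[-\pi,\pi]$, $$\mathcal{E}_n^k(ix)\,\mathcal{E}_n^k(iy)=\int_{-\pi}^{\pi}\mathcal{E}_n^k(iz)\,d\mu_k^{(x,y)}(z),$$ where $d\mu_k^{(x,y)}(z)=\mathcal{W}_k(x,y,z)\,dm_k(z)$ if $\sin x\sin y\ne 0$; $\mu_k^{(x,y)}=\delta_x$ if $y=0$; $\mu_k^{(x,y)}=\delta_y$ if $x=0$; $\mu_k^{(x,y)}$ is the Dirac mass at the point of $[-\pi,\pi]$ congruent to $x+\pi$ modulo $2\pi$ if $y=\pm\pi$; and $\mu_k^{(x,y)}$ is the Dirac mass at the point of $[-\pi,\pi]$ congruent to $y+\pi$ modulo $2\pi$ if $x=\pm\pi$.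
   Context: Fix $k>0$. The Cherednik operator of type $A_1$ is $T^k f(x)=f'(x)+2k\,\frac{f(x)-f(-x)}{1-e^{-2x}}-k f(x)$. On $\mathbb{Z}$ define the partial order $j\triangleleft n$ iff either ($|j|<|n|$ and $|n|-|j|$ is a positive even integer) or ($|j|=|n|$ and $n<j$). Let $dm_k(x)=|\sin x|^{2k}dx$ on $[-\pi,\pi]$ and $(f,g)_k=\int_{-\pi}^{\pi}f\bar g\,dm_k$. For $n\in\mathbb{Z}$, $E_n^k$ is the unique function $E_n^k(z)=e^{nz}+\sum_{j\triangleleft n}c_{n,j}e^{jz}$ ($z\in\mathbb{C}$) with $(E_n^k(i\cdot),e^{ij\cdot})_k=0$ for all $j\triangleleft n$; the $c_{n,j}$ are real and nonnegative, $T^kE_n^k=n_kE_n^k$ ($n_k=n+k$ for $n>0$, $n_k=n-k$ for $n\le0$), and $E_n^k(0)>0$. Set $\mathcal{E}_n^k(ix)=E_n^k(ix)/E_n^k(0)$. For $x,y,z\in[-\pi,\pi]$ with $\sin x\sin y\sin z\ne 0$ define $$W_k(x,y,z)=\frac{\Gamma(k+\tfrac12)}{2\Gamma(k)\sqrt{\pi}}\cdot\frac{\bigl\{(\cos z-\cos(x+y))(\cos(x-y)-\cos z)\bigr\}^{k-1}}{|\sin x\sin y\sin z|^{2k-1}}$$ if $\cos(|x|+|y|)<\cos z<\cos(|x|-|y|)$, and $W_k(x,y,z)=0$ otherwise; and $$\mathcal{W}_k(x,y,z)=4\exp\!\Big(\tfrac{i}{2}(x+y-z)\Big)\frac{\sin\frac{x+y+z}{2}\,\sin\frac{-x+y+z}{2}\,\sin\frac{x-y+z}{2}}{\sin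 x\sin y\sin z}\,W_k(x,y,z).$$ $\delta_a$ denotes the Dirac measure at $a$. *)

theory Defs
  imports "HOL-Analysis.Analysis"
begin

definition tri :: "int \<Rightarrow> int \<Rightarrow> bool" where
  "tri j n \<longleftrightarrow> (\<bar>j\<bar> < \<bar>n\<bar> \<and> even (\<bar>n\<bar> - \<bar>j\<bar>)) \<or> (\<bar>j\<bar> = \<bar>n\<bar> \<and> n < j)"

definition ip :: "real \<Rightarrow> (real \<Rightarrow> complex) \<Rightarrow> (real \<Rightarrow> complex) \<Rightarrow> complex" where
  "ip k f g = integral {-pi..pi}
      (\<lambda>x. f x * cnj (g x) * complex_of_real (\<bar>sin x\<bar> powr (2 * k)))"

definition Epoly :: "int \<Rightarrow> (int \<Rightarrow> complex) \<Rightarrow> complex \<Rightarrow> complex" where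
  "Epoly n c z = exp (of_int n * z) + (\<Sum>j\<in>{j. tri j n}. c j * exp (of_int j * z))"

definition coefs :: "real \<Rightarrow> int \<Rightarrow> int \<Rightarrow> complex" where
  "coefs k n = (THE c. (\<forall>j. \<not> tri j n \<longrightarrow> c j = 0) \<and>
      (\<forall>j. tri j n \<longrightarrow>
         ip k (\<lambda>x. Epoly n c (\<i> * of_real x)) (\<lambda>x. exp (\<i> * of_int j * of_real x)) = 0))"

definition Eop :: "real \<Rightarrow> int \<Rightarrow> complex \<Rightarrow> complex" where
  "Eop k n z = Epoly n (coefs k n) z"

definition calE :: "real \<Rightarrow> int \<Rightarrow> complex \<Rightarrow> complex" where
  "calE k n z = Eop k n z / Eop k n 0"

definition Wk :: "real \<Rightarrow> real \<Rightarrow> real \<Rightarrow> real \<Rightarrow> real" where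
  "Wk k x y z =
     (if cos (\<bar>x\<bar> + \<bar>y\<bar>) < cos z \<and> cos z < cos (\<bar>x\<bar> - \<bar>y\<bar>) then
        Gamma (k + 1/2) / (2 * Gamma k * sqrt pi) *
        (((cos z - cos (x + y)) * (cos (x - y) - cos z)) powr (k - 1)) /
        (\<bar>sin x * sin y * sin z\<bar> powr (2 * k - 1))
      else 0)"

definition calW :: "real \<Rightarrow> real \<Rightarrow> real \<Rightarrow> real \<Rightarrow> complex" where
  "calW k x y z =
     4 * exp (\<i> / 2 * of_real (x + y - z)) *
     of_real (sin ((x + y + z) / 2) * sin ((- x + y + z) / 2) * sin ((x - y + z) / 2)
              / (sin x * sin y * sin z)) *
     of_real (Wk k x y z)"

end

theory Submission
  imports Defs
begin

text \<open>
  Write \<open>A\<^sub>y f(x)\<close> for the integral of \<open>f(z)\<close> against \<open>\<W>\<^sub>k(x,y,z) dm\<^sub>k(z)\<close>. The substitution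
  \<open>cos z = cos x cos y + sin x sin y t\<close> turns it into an average over \<open>t \<in> (-1,1)\<close> with the probability
  density proportional to \<open>(1 - t) (1 - t\<^sup>2)\<^bsup>k-1\<^esup>\<close>, from which one reads off that \<open>A\<^sub>y\<close> maps
  \<open>e\<^bsup>inx\<^esup>\<close> into the span of the \<open>e\<^bsup>ijx\<^esup>\<close> with \<open>j = n\<close> or \<open>j \<triangleleft> n\<close>, and that
  \<open>A\<^sub>y f(0) = f(y)\<close>. The kernel satisfies \<open>\<W>\<^sub>k(x,y,z) = cnj \<W>\<^sub>k(z,-y,x)\<close>, so \<open>A\<^sub>-\<^sub>y\<close> is the adjoint of
  \<open>A\<^sub>y\<close> in \<open>L\<^sup>2(m\<^sub>k)\<close>. Hence \<open>A\<^sub>y E\<^sub>n\<close> lies in the span of the \<open>e\<^bsup>ijx\<^esup>\<close>, \<open>j = n\<close> or \<open>j \<triangleleft> n\<close>, and is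
  orthogonal to those with \<open>j \<triangleleft> n\<close>: it is a multiple of \<open>E\<^sub>n\<close>, and evaluation at
  \<open>x = 0\<close> identifies the factor as \<open>E\<^sub>n(y) / E\<^sub>n(0)\<close>.
\<close>

section \<open>The kernel\<close>

text \<open>The Gram determinant of three unit vectors at mutual angles \<open>x, y, z\<close>. It is symmetric in
  \<open>x, y, z\<close> and positive exactly on the support of \<open>W\<^sub>k\<close>.\<close>

definition disc :: "real \<Rightarrow> real \<Rightarrow> real \<Rightarrow> real" where
  "disc x y z = (cos z - cos (x + y)) * (cos (x - y) - cos z)"

text \<open>The quotient of \<open>calW\<close> by \<open>Wk\<close>, with the phase and the
  half-angle sines rewritten by product-to-sum formulas, so that z enters only through
  \<open>cos z\<close> and \<open>sin z\<close>.\<close>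

definition calW_factor :: "real \<Rightarrow> real \<Rightarrow> real \<Rightarrow> complex" where
  "calW_factor x y z =
     of_real ((cos (x - y) - cos z) / (sin x * sin y * sin z)) *
     Complex (sin (x + y) + sin z) (cos z - cos (x + y))"

lemma disc_eq: "disc x y z = (sin x * sin y)\<^sup>2 - (cos z - cos x * cos y)\<^sup>2"
  by (simp add: disc_def cos_add cos_diff power2_eq_square algebra_simps)

lemma disc_swap: "disc z y x = disc x y z"
proof -
  have "disc x y z = 1 - (cos x)\<^sup>2 - (cos y)\<^sup>2 - (cos z)\<^sup>2 + 2 * cos x * cos y * cos z" for x y z
    unfolding disc_eq power_mult_distrib sin_squared_eq by (simp add: power2_eq_square algebra_simps)
  then show ?thesis by simp
qed

lemma disc_commute: "disc y x z = disc x y z"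
  unfolding disc_eq by (simp add: mult.commute)

lemma disc_minus [simp]: "disc x (- y) z = disc x y z"
  unfolding disc_eq by simp

lemma sin_abs: "sin \<bar>x\<bar> = \<bar>sin x\<bar>" if "\<bar>x\<bar> \<le> pi"
  using sin_ge_zero[of "\<bar>x\<bar>"] that by (auto simp: abs_if split: if_splits)

text \<open>Together the two inequalities on \<open>cos z\<close> say |cos z - cos x cos y| < |sin x
  sin y|, which squares to \<open>disc x y z > 0\<close>. The bounds on x and y give sin |x| = |sin
  x|. In this form \<open>Wk\<close> inherits the symmetry of \<open>disc\<close>.\<close>

lemma Wk_eq_disc:
  assumes "\<bar>x\<bar> \<le> pi" "\<bar>y\<bar> \<le> pi"
  shows "Wk k x y z = (if disc x y z > 0 then
           Gamma (k + 1/2) / (2 * Gamma k * sqrt pi) * disc x y z powr (k - 1) /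
           (\<bar>sin x * sin y * sin z\<bar> powr (2 * k - 1)) else 0)"
proof -
  have s: "sin \<bar>x\<bar> * sin \<bar>y\<bar> = \<bar>sin x * sin y\<bar>" "cos \<bar>x\<bar> * cos \<bar>y\<bar> = cos x * cos y"
    by (simp_all add: abs_mult sin_abs assms)
  let ?q = "cos z - cos x * cos y"
  have "cos (\<bar>x\<bar> + \<bar>y\<bar>) < cos z \<and> cos z < cos (\<bar>x\<bar> - \<bar>y\<bar>) \<longleftrightarrow> \<bar>?q\<bar> < \<bar>sin x * sin y\<bar>"
    unfolding cos_add cos_diff s by linarith
  also have "\<dots> \<longleftrightarrow> disc x y z > 0"
    unfolding disc_eq by (metis abs_le_square_iff diff_gt_0_iff_gt not_le)
  finally show ?thesis
    unfolding Wk_def disc_def by simp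
qed

lemma calW_eq: "calW k x y z = calW_factor x y z * of_real (Wk k x y z)"
proof -
  \<comment> \<open>The phase is exp(i d). Paired with sin((x + y + z)/2), it produces the angles x
    + y and z; the other two sines produce z and x - y.\<close>
  define d where "d = (x + y - z) / 2"
  have ad: "(x + y + z) / 2 + d = x + y" "(x + y + z) / 2 - d = z"
    by (simp_all add: d_def field_simps)
  have bc: "(- x + y + z) / 2 + (x - y + z) / 2 = z" "(- x + y + z) / 2 - (x - y + z) / 2 = - (x - y)"
    by (simp_all add: field_simps)
  have a: "2 * (sin ((x + y + z) / 2) * cos d) = sin (x + y) + sin z"
    using sin_times_cos[of "(x + y + z) / 2" d] by (simp add: ad)
  have b: "2 * (sin ((x + y + z) / 2) * sin d) = cos z - cos (x + y)"
    using sin_times_sin[of "(x + y + z) / 2" d] by (simp add: ad)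
  have c: "2 * (sin ((- x + y + z) / 2) * sin ((x - y + z) / 2)) = cos (x - y) - cos z"
    using sin_times_sin[of "(- x + y + z) / 2" "(x - y + z) / 2"]
    unfolding bc cos_minus by simp
  have e: "exp (\<i> / 2 * of_real (x + y - z)) = Complex (cos d) (sin d)"
    using cis_conv_exp[of d] by (simp add: d_def cis.ctr mult.commute)
  have "4 * exp (\<i> / 2 * of_real (x + y - z)) *
     of_real (sin ((x + y + z) / 2) * sin ((- x + y + z) / 2) * sin ((x - y + z) / 2)
              / (sin x * sin y * sin z)) =
     of_real (2 * (sin ((- x + y + z) / 2) * sin ((x - y + z) / 2)) / (sin x * sin y * sin z)) *
     Complex (2 * (sin ((x + y + z) / 2) * cos d)) (2 * (sin ((x + y + z) / 2) * sin d))"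
    unfolding e by (simp add: complex_eq_iff)
  then show ?thesis
    unfolding calW_def calW_factor_def a b c by (simp only:)
qed

lemma Wk_swap:
  assumes "\<bar>x\<bar> \<le> pi" "\<bar>y\<bar> \<le> pi" "\<bar>z\<bar> \<le> pi"
  shows "Wk k z (- y) x = Wk k x y z"
  using assms by (simp add: Wk_eq_disc disc_swap[of z] abs_mult mult_ac)

text \<open>Passing from (x, y, z) to (z, -y, x) exchanges half-angle sines up to one sign, which
  the sign of sin(-y) compensates, and reverses the phase, which conjugation compensates.\<close>

lemma calW_swap:
  assumes "\<bar>x\<bar> \<le> pi" "\<bar>y\<bar> \<le> pi" "\<bar>z\<bar> \<le> pi"
  shows "cnj (calW k z (- y) x) = calW k x y z"
proof -
  have a: "sin ((z - y + x) / 2) = sin ((x - y + z) / 2)"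
    "sin ((- z + - y + x) / 2) = - sin ((- x + y + z) / 2)"
    "sin ((z + y + x) / 2) = sin ((x + y + z) / 2)"
    using sin_minus[of "(- x + y + z) / 2"] by (simp_all add: algebra_simps minus_divide_left)
  have e: "cnj (exp (\<i> / 2 * of_real (z + - y - x))) = exp (\<i> / 2 * of_real (x + y - z))"
    unfolding exp_cnj by (rule arg_cong[of _ _ exp]) (simp add: field_simps)
  show ?thesis
    unfolding calW_def Wk_swap[OF assms]
    using a e by (simp add: mult_ac)
qed

text \<open>The quotients \<open>t, u, v\<close> below are the cosines of the angles of the spherical triangle with sides
  \<open>x, y, z\<close>, hence bounded by 1.\<close>

lemma norm_calW_le:
  assumes "\<bar>x\<bar> \<le> pi" "\<bar>y\<bar> \<le> pi"
  shows "cmod (calW k x y z) \<le> 5 * \<bar>Wk k x y z\<bar>"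
proof (cases "disc x y z > 0")
  case False
  then show ?thesis by (simp add: calW_eq Wk_eq_disc assms)
next
  case True
  have nz: "sin x \<noteq> 0" "sin y \<noteq> 0"
    using True by (auto simp: disc_eq)
  have nz': "sin z \<noteq> 0"
    using True disc_eq[of z y x] by (auto simp: disc_swap[of z])
  have q: "\<bar>(cos a - cos b * cos c) / (sin b * sin c)\<bar> \<le> 1"
    if "disc b c a = disc x y z" "sin b \<noteq> 0" "sin c \<noteq> 0" for a b c
  proof -
    have "(cos a - cos b * cos c)\<^sup>2 \<le> (sin b * sin c)\<^sup>2"
      using True that by (simp add: disc_eq)
    then show ?thesis using that by (simp add: abs_le_square_iff divide_le_eq)
  qed
  define t where "t = (cos z - cos x * cos y) / (sin x * sin y)"
  define u where "u = (cos x - cos y * cos z) / (sin y * sin z)"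
  define v where "v = (cos y - cos x * cos z) / (sin x * sin z)"
  define w where "w = disc x y z / (sin x * sin y * sin z)"
  have "\<bar>t\<bar> \<le> 1" unfolding t_def by (rule q) (use nz nz' in auto)
  moreover have "\<bar>u\<bar> \<le> 1" unfolding u_def
    by (rule q) (use nz nz' in \<open>auto simp: disc_swap[of y] disc_commute disc_swap\<close>, metis disc_commute disc_swap)
  moreover have "\<bar>v\<bar> \<le> 1" unfolding v_def
    by (rule q) (use nz nz' in auto, metis disc_commute disc_swap)
  \<comment> \<open>\<open>disc\<close> is at most (sin x sin y)^2 and, by its symmetry, at most
    (sin z sin y)^2. The product of these bounds is (sin x sin y sin z)^2 (sin y)^2.\<close>
  moreover have "\<bar>w\<bar> \<le> 1"
  proof -
    have "disc x y z \<le> (sin x * sin y)\<^sup>2"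
      by (simp add: disc_eq)
    moreover have "disc x y z \<le> (sin z * sin y)\<^sup>2"
      using disc_eq[of z y x] disc_swap[of z y x] zero_le_power2[of "cos x - cos z * cos y"] by linarith
    ultimately have "(disc x y z)\<^sup>2 \<le> (sin x * sin y)\<^sup>2 * (sin z * sin y)\<^sup>2"
      using True unfolding power2_eq_square[of "disc x y z"] by (intro mult_mono) auto
    also have "\<dots> = (sin x * sin y * sin z)\<^sup>2 * (sin y)\<^sup>2"
      by (simp add: power2_eq_square)
    also have "\<dots> \<le> (sin x * sin y * sin z)\<^sup>2 * 1"
      by (intro mult_left_mono) (auto simp: abs_square_le_1)
    finally show ?thesis
      using nz nz' by (simp add: w_def abs_le_square_iff divide_le_eq)
  qed
  moreover have "calW_factor x y z = Complex (1 - t + u + v) w"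
  proof -
    have 1: "(cos (x - y) - cos z) * (sin (x + y) + sin z) =
       sin x * sin y * sin z * (1 - t + u + v)"
    proof -
      have "sin x * sin y * sin z * (1 - t + u + v) = sin x * sin y * sin z
         - sin z * (cos z - cos x * cos y) + sin x * (cos x - cos y * cos z) + sin y * (cos y - cos x * cos z)"
        using nz nz' unfolding t_def u_def v_def by (simp add: field_simps)
      also have "\<dots> = (cos (x - y) - cos z) * (sin (x + y) + sin z)"
        unfolding sin_add cos_diff using sin_cos_squared_add[of x] sin_cos_squared_add[of y] by algebra
      finally show ?thesis ..
    qed
    have 2: "(cos (x - y) - cos z) * (cos z - cos (x + y)) = sin x * sin y * sin z * w"
      using nz nz' by (simp add: w_def disc_def mult.commute)
    show ?thesis
      unfolding calW_factor_def using 1 2 nz nz' by (simp add: complex_eq_iff)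
  qed
  \<comment> \<open>The real part 1 - t + u + v is at most 4 in modulus and the imaginary part w at
    most 1.\<close>
  ultimately have "cmod (calW_factor x y z) \<le> 5"
    using cmod_le[of "calW_factor x y z"] by simp
  then show ?thesis
    by (simp add: calW_eq norm_mult mult_right_mono)
qed

section \<open>The substitution\<close>

definition gegenbauer_weight :: "real \<Rightarrow> real \<Rightarrow> real" where
  "gegenbauer_weight k t = (1 - t\<^sup>2) powr (k - 1)"

text \<open>The Beta integral, carried from [0,1] to [-1,1] by s = (1 + t)/2. Clearing the halves in
  the two powers costs 2 powr (a + b - 2), and the Jacobian contributes one more factor 2.\<close>

lemma has_integral_jacobi_weight:
  fixes a b :: real
  assumes "a > 0" "b > 0"
  shows "((\<lambda>t. (1 - t) powr (a - 1) * (1 + t) powr (b - 1)) has_integral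
           2 powr (a + b - 1) * Beta a b) {-1<..<1}"
proof -
  have "((\<lambda>t. (1/2 * t + 1/2) powr (b - 1) * (1 - (1/2 * t + 1/2)) powr (a - 1)) has_integral
          2 * Beta a b) {-1..1}"
    using has_integral_affinity'[of "\<lambda>t. t powr (b - 1) * (1 - t) powr (a - 1)" "Beta b a" 0 1 "1/2" "1/2"]
      has_integral_Beta_real[of b a] assms by (simp add: Beta_commute)
  then have "((\<lambda>t. 2 powr (a + b - 2) * ((1/2 * t + 1/2) powr (b - 1) * (1 - (1/2 * t + 1/2)) powr (a - 1)))
          has_integral 2 powr (a + b - 2) * (2 * Beta a b)) {-1<..<1}"
    by (intro has_integral_mult_right) (simp add: has_integral_Icc_iff_Ioo)
  moreover have "2 powr (a + b - 2) * (2 * Beta a b) = 2 powr (a + b - 1) * Beta a b"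
    using powr_add[of 2 "a + b - 2" 1] by simp
  moreover have "2 powr (a + b - 2) * ((1/2 * t + 1/2) powr (b - 1) * (1 - (1/2 * t + 1/2)) powr (a - 1))
      = (1 - t) powr (a - 1) * (1 + t) powr (b - 1)" if "t \<in> {-1<..<1}" for t :: real
  proof -
    have "(1/2 * t + 1/2) = (1 + t) / 2" "1 - (1/2 * t + 1/2) = (1 - t) / 2"
      by (simp_all add: field_simps)
    moreover have "2 powr (a + b - 2) = 2 powr (a - 1) * 2 powr (b - 1)"
      by (simp flip: powr_add)
    ultimately show ?thesis
      using that by (simp only:) (simp add: powr_divide)
  qed
  ultimately show ?thesis
    by (subst has_integral_cong[symmetric]) (auto simp: )
qed

lemma gegenbauer_weight_nonneg: "gegenbauer_weight k t \<ge> 0"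
  by (simp add: gegenbauer_weight_def)

lemma gegenbauer_weight_eq:
  assumes "t \<in> {-1<..<1}"
  shows "gegenbauer_weight k t = (1 - t) powr (k - 1) * (1 + t) powr (k - 1)"
    and "(1 - t) * gegenbauer_weight k t = (1 - t) powr (k + 1 - 1) * (1 + t) powr (k - 1)"
proof -
  have "1 - t\<^sup>2 = (1 - t) * (1 + t)"
    by (simp add: power2_eq_square algebra_simps)
  then show *: "gegenbauer_weight k t = (1 - t) powr (k - 1) * (1 + t) powr (k - 1)"
    using assms by (simp add: gegenbauer_weight_def powr_mult)
  show "(1 - t) * gegenbauer_weight k t = (1 - t) powr (k + 1 - 1) * (1 + t) powr (k - 1)"
    unfolding * using assms powr_add[of "1 - t" "k - 1" 1] by simp
qed

lemma gegenbauer_weight_integrable: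
  assumes "k > 0"
  shows "gegenbauer_weight k absolutely_integrable_on {-1<..<1}"
proof (rule nonnegative_absolutely_integrable_1)
  show "gegenbauer_weight k integrable_on {-1<..<1}"
    using has_integral_integrable[OF has_integral_jacobi_weight[OF assms assms]]
    by (rule integrable_eq) (simp add: gegenbauer_weight_eq)
qed (simp add: gegenbauer_weight_nonneg)

text \<open>The integral is 2^(2k) Beta(k + 1, k). Legendre duplication identifies it as the
  reciprocal of the constant in \<open>jacobi_mean\<close>, so that the averaging density has total
  mass 1.\<close>

lemma integral_one_minus_gegenbauer_weight:
  assumes "k > 0"
  shows "integral {-1<..<1} (\<lambda>t. (1 - t) * gegenbauer_weight k t) = Gamma k * sqrt pi / Gamma (k + 1/2)"
proof -
  have nonpos: "k \<notin> \<int>\<^sub>\<le>\<^sub>0" "k + 1/2 \<notin> \<int>\<^sub>\<le>\<^sub>0" "2 * k \<notin> \<int>\<^sub>\<le>\<^sub>0"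
    using assms by (auto simp: nonpos_Ints_def)
  \<comment> \<open>Duplication is applied at a complex point and carried back to the reals factor
    by factor.\<close>
  have "Gamma (complex_of_real k) * Gamma (complex_of_real k + 1 / 2) =
     exp ((1 - 2 * complex_of_real k) * complex_of_real (ln 2)) * complex_of_real (sqrt pi) * Gamma (2 * complex_of_real k)"
    using nonpos of_real_in_nonpos_Ints_iff[of k, where ?'a = complex]
      of_real_in_nonpos_Ints_iff[of "k + 1/2", where ?'a = complex]
    by (intro Gamma_legendre_duplication) auto
  also have "Gamma (complex_of_real k + 1 / 2) = of_real (Gamma (k + 1/2))"
    using Gamma_complex_of_real[of "k + 1/2"] by simp
  also have "Gamma (2 * complex_of_real k) = of_real (Gamma (2 * k))"
    using Gamma_complex_of_real[of "2 * k"] by simp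
  also have "exp ((1 - 2 * complex_of_real k) * complex_of_real (ln 2)) = of_real (2 powr (1 - 2 * k))"
    by (simp add: powr_def flip: exp_of_real)
  finally have "complex_of_real (Gamma k * Gamma (k + 1/2)) = of_real (2 powr (1 - 2 * k) * sqrt pi * Gamma (2 * k))"
    by (simp add: Gamma_complex_of_real)
  then have dup: "Gamma k * Gamma (k + 1/2) = 2 powr (1 - 2 * k) * sqrt pi * Gamma (2 * k)"
    by (simp only: of_real_eq_iff)
  have pos: "Gamma k > 0" "Gamma (k + 1/2) > 0" "Gamma (2 * k) > 0"
    using assms by (simp_all add: Gamma_real_pos)
  have "integral {-1<..<1} (\<lambda>t. (1 - t) * gegenbauer_weight k t) =
      integral {-1<..<1} (\<lambda>t. (1 - t) powr (k + 1 - 1) * (1 + t) powr (k - 1))"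
    by (intro integral_cong) (simp only: gegenbauer_weight_eq(2))
  also have "\<dots> = 2 powr (k + 1 + k - 1) * Beta (k + 1) k"
    using has_integral_jacobi_weight[of "k + 1" k] assms by (intro integral_unique) auto
  also have "\<dots> = 2 powr (2 * k) * (Gamma (k + 1) * Gamma k / Gamma (2 * k + 1))"
    by (simp add: Beta_def algebra_simps)
  also have "Gamma (k + 1) = k * Gamma k"
    by (rule Gamma_plus1) fact
  also have "Gamma (2 * k + 1) = 2 * k * Gamma (2 * k)"
    by (rule Gamma_plus1) fact
  also have "2 powr (2 * k) * (k * Gamma k * Gamma k / (2 * k * Gamma (2 * k))) =
      Gamma k * sqrt pi / Gamma (k + 1/2)"
  proof -
    have "2 powr (2 * k) * (k * Gamma k * Gamma k / (2 * k * Gamma (2 * k))) * Gamma (k + 1/2) =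
      2 powr (2 * k) * Gamma k / (2 * Gamma (2 * k)) * (Gamma k * Gamma (k + 1/2))"
      using assms by (simp add: field_simps)
    also have "\<dots> = (2 powr (2 * k) * 2 powr (1 - 2 * k)) * (Gamma k * sqrt pi) / 2"
      unfolding dup using pos by (simp add: field_simps)
    also have "\<dots> = Gamma k * sqrt pi"
      by (simp flip: powr_add)
    finally show ?thesis using pos by (simp add: field_simps)
  qed
  finally show ?thesis .
qed

text \<open>In the spherical law of cosines, t is the cosine of the angle between the sides x and y.
  Strictness keeps z = arccos(...) away from 0 and pi, where \<open>arccos\<close> is not
  differentiable and \<open>sin z\<close> vanishes.\<close>

lemma cos_combination_less_1:
  fixes t :: real
  assumes nz: "sin x * sin y \<noteq> 0" and "\<bar>t\<bar> < 1"
  shows "\<bar>cos x * cos y + sin x * sin y * t\<bar> < 1"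
proof -
  have "1 - (cos x * cos y + sin x * sin y * t)\<^sup>2 =
      (sin x)\<^sup>2 * (1 - t\<^sup>2) + (cos x * sin y - sin x * cos y * t)\<^sup>2"
    using sin_cos_squared_add[of x] sin_cos_squared_add[of y] by algebra
  moreover have "(sin x)\<^sup>2 * (1 - t\<^sup>2) > 0"
    using assms by (intro mult_pos_pos) (auto simp: abs_square_less_1)
  ultimately have "1 - (cos x * cos y + sin x * sin y * t)\<^sup>2 > 0"
    by (simp add: add_pos_nonneg)
  then show ?thesis by (simp add: abs_square_less_1)
qed

text \<open>With P = sin x sin y and cos z = cos x cos y + P t, \<open>disc\<close> becomes P^2 (1 -
  t^2) and |dz/dt| = |P| / sin z. Multiplied by \<open>Wk\<close> and |sin z|^(2k), all powers of
  |P| and sin z cancel: the exponents are (2k - 2) + 1 - (2k - 1) = 0 and -1 + 2k - (2k - 1) = 0.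
  Only the power of 1 - t^2 survives, whatever the sign of P.\<close>

lemma arccos_substitution:
  fixes \<phi> :: "real \<Rightarrow> 'a :: euclidean_space"
  assumes "\<bar>x\<bar> \<le> pi" "\<bar>y\<bar> \<le> pi" and nz: "sin x * sin y \<noteq> 0"
    and int: "(\<lambda>t. gegenbauer_weight k t *\<^sub>R \<phi> (arccos (cos x * cos y + sin x * sin y * t)))
            absolutely_integrable_on {-1<..<1}"
  shows "(\<lambda>z. (Wk k x y z * \<bar>sin z\<bar> powr (2 * k)) *\<^sub>R \<phi> z) absolutely_integrable_on {0..pi}"
    and "integral {0..pi} (\<lambda>z. (Wk k x y z * \<bar>sin z\<bar> powr (2 * k)) *\<^sub>R \<phi> z) =
      (Gamma (k + 1/2) / (2 * Gamma k * sqrt pi)) *\<^sub>R integral {-1<..<1}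
        (\<lambda>t. gegenbauer_weight k t *\<^sub>R \<phi> (arccos (cos x * cos y + sin x * sin y * t)))"
proof -
  define P where "P = sin x * sin y"
  define C where "C = Gamma (k + 1/2) / (2 * Gamma k * sqrt pi)"
  define u where "u t = cos x * cos y + P * t" for t
  define g where "g t = arccos (u t)" for t
  define D where "D = {z \<in> {0..pi}. disc x y z > 0}"
  define h where "h t = inverse (- sqrt (1 - (u t)\<^sup>2)) * P" for t
  define f where "f z = (Wk k x y z * \<bar>sin z\<bar> powr (2 * k)) *\<^sub>R \<phi> z" for z
  have P: "P \<noteq> 0" using nz by (simp add: P_def)
  have u1: "-1 < u t" "u t < 1" if "t \<in> {-1<..<1}" for t
    using cos_combination_less_1[OF nz, of t] that unfolding u_def P_def by (auto simp: abs_less_iff)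
  have u: "1 - (u t)\<^sup>2 > 0" if "t \<in> {-1<..<1}" for t
    using u1[OF that] by (auto simp: abs_square_less_1)
  have cosg: "cos (g t) = u t" and sing: "sin (g t) = sqrt (1 - (u t)\<^sup>2)" if "t \<in> {-1<..<1}" for t
    unfolding g_def using u1[OF that] by (simp_all add: cos_arccos sin_arccos)
  have discg: "disc x y (g t) = P\<^sup>2 * (1 - t\<^sup>2)" if "t \<in> {-1<..<1}" for t
    unfolding disc_eq cosg[OF that] by (simp add: u_def P_def power2_eq_square algebra_simps)
  have img: "g ` {-1<..<1} = D"
  proof (intro equalityI subsetI)
    fix z assume "z \<in> g ` {-1<..<1}"
    then obtain t where t: "t \<in> {-1<..<1}" "z = g t" by blast
    have "disc x y z > 0"
      unfolding t(2) discg[OF t(1)] using t(1) P by (intro mult_pos_pos) (auto simp: abs_square_less_1)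
    moreover have "z \<in> {0..pi}"
      unfolding t(2) g_def using u1[OF t(1)] by (simp add: arccos_lbound arccos_ubound)
    ultimately show "z \<in> D" by (simp add: D_def)
  next
    fix z assume z: "z \<in> D"
    define t where "t = (cos z - cos x * cos y) / P"
    have "(cos z - cos x * cos y)\<^sup>2 < P\<^sup>2" using z by (simp add: D_def disc_eq P_def)
    then have "t\<^sup>2 < 1" using P by (simp add: t_def power_divide)
    then have t: "t \<in> {-1<..<1}" by (auto simp: abs_square_less_1 abs_less_iff)
    have "g t = z" unfolding g_def u_def t_def using P z by (simp add: D_def arccos_cos)
    then show "z \<in> g ` {-1<..<1}" using t by blast
  qed
  have inj: "inj_on g {-1<..<1}"
  proof (rule inj_onI)
    fix s t :: real assume st: "s \<in> {-1<..<1}" "t \<in> {-1<..<1}" "g s = g t"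
    then have "u s = u t" using cosg by metis
    then show "s = t" using P by (simp add: u_def)
  qed
  have der: "(g has_field_derivative h t) (at t within {-1<..<1})" if "t \<in> {-1<..<1}" for t
  proof -
    have "(u has_field_derivative P) (at t)"
      unfolding u_def by (auto intro!: derivative_eq_intros)
    then have "(g has_field_derivative h t) (at t)"
      unfolding g_def h_def by (intro DERIV_chain2[OF DERIV_arccos] u1 that)
    then show ?thesis by (rule has_field_derivative_at_within)
  qed
  have fg: "\<bar>h t\<bar> *\<^sub>R f (g t) = C *\<^sub>R (gegenbauer_weight k t *\<^sub>R \<phi> (g t))" if t: "t \<in> {-1<..<1}" for t
  proof -
    define S where "S = sqrt (1 - (u t)\<^sup>2)"
    have S: "S > 0" using u[OF t] by (simp add: S_def)
    have t2: "1 - t\<^sup>2 > 0" using t by (auto simp: abs_square_less_1)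
    have sabs: "\<bar>sin (g t)\<bar> = S"
      using S unfolding sing[OF t] S_def by simp
    have habs: "\<bar>h t\<bar> = \<bar>P\<bar> / S"
      using S unfolding h_def S_def[symmetric] by (simp add: abs_mult divide_inverse)
    have "P\<^sup>2 * (1 - t\<^sup>2) > 0"
      using P t2 by simp
    then have Wg: "Wk k x y (g t) = C * (P\<^sup>2 * (1 - t\<^sup>2)) powr (k - 1) / (\<bar>P\<bar> * S) powr (2 * k - 1)"
      unfolding Wk_eq_disc[OF assms(1,2)] discg[OF t] P_def[symmetric] C_def abs_mult[of P] sabs
      by (simp only: if_True)
    have "\<bar>h t\<bar> * (Wk k x y (g t) * \<bar>sin (g t)\<bar> powr (2 * k)) =
       \<bar>P\<bar> / S * (C * (P\<^sup>2 * (1 - t\<^sup>2)) powr (k - 1) / (\<bar>P\<bar> * S) powr (2 * k - 1) * S powr (2 * k))"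
      by (simp only: habs Wg sabs)
    also have "(P\<^sup>2 * (1 - t\<^sup>2)) powr (k - 1) = \<bar>P\<bar> powr (2 * k - 2) * gegenbauer_weight k t"
      using t2 P powr_powr[of "\<bar>P\<bar>" 2 "k - 1"]
      by (subst powr_mult) (auto simp: gegenbauer_weight_def algebra_simps)
    also have "\<bar>P\<bar> / S * (C * (\<bar>P\<bar> powr (2 * k - 2) * gegenbauer_weight k t) / (\<bar>P\<bar> * S) powr (2 * k - 1) * S powr (2 * k))
      = C * gegenbauer_weight k t"
    proof -
      have "S powr (2 * k) = S powr (2 * k - 1) * S"
        using S powr_add[of S "2 * k - 1" 1] by simp
      moreover have "\<bar>P\<bar> powr (2 * k - 1) = \<bar>P\<bar> powr (2 * k - 2) * \<bar>P\<bar>"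
        using P powr_add[of "\<bar>P\<bar>" "2 * k - 2" 1] by simp
      ultimately show ?thesis
        using S P by (simp add: powr_mult)
    qed
    finally show ?thesis unfolding f_def by simp
  qed
  have int': "(\<lambda>t. gegenbauer_weight k t *\<^sub>R \<phi> (g t)) absolutely_integrable_on {-1<..<1}"
    using int unfolding g_def u_def P_def .
  have "(\<lambda>t. \<bar>h t\<bar> *\<^sub>R f (g t)) absolutely_integrable_on {-1<..<1} \<and>
      integral {-1<..<1} (\<lambda>t. \<bar>h t\<bar> *\<^sub>R f (g t)) =
      C *\<^sub>R integral {-1<..<1} (\<lambda>t. gegenbauer_weight k t *\<^sub>R \<phi> (g t))"
  proof
    have "(\<lambda>t. C *\<^sub>R (gegenbauer_weight k t *\<^sub>R \<phi> (g t))) absolutely_integrable_on {-1<..<1}"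
      using int' by (rule absolutely_integrable_scaleR_left)
    then show "(\<lambda>t. \<bar>h t\<bar> *\<^sub>R f (g t)) absolutely_integrable_on {-1<..<1}"
      by (rule absolutely_integrable_spike[of _ _ "{}"]) (use fg in auto)
    show "integral {-1<..<1} (\<lambda>t. \<bar>h t\<bar> *\<^sub>R f (g t)) =
      C *\<^sub>R integral {-1<..<1} (\<lambda>t. gegenbauer_weight k t *\<^sub>R \<phi> (g t))"
      unfolding integral_cmul[symmetric] by (intro integral_cong fg)
  qed
  then have D: "f absolutely_integrable_on D"
    "integral D f = C *\<^sub>R integral {-1<..<1} (\<lambda>t. gegenbauer_weight k t *\<^sub>R \<phi> (g t))"
    using has_absolute_integral_change_of_variables_real[OF _ der inj, of f] unfolding img by auto
  \<comment> \<open>\<open>Wk\<close> vanishes outside \<open>D\<close>, so \<open>D\<close> can be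
    enlarged to [0, pi] without changing the integral.\<close>
  have ext: "(if z \<in> D then f z else 0) = (if z \<in> {0..pi} then f z else 0)" for z
    by (auto simp: D_def f_def Wk_eq_disc[OF assms(1,2)])
  show "(\<lambda>z. (Wk k x y z * \<bar>sin z\<bar> powr (2 * k)) *\<^sub>R \<phi> z) absolutely_integrable_on {0..pi}"
    using D(1) unfolding f_def[symmetric] absolutely_integrable_restrict_UNIV[symmetric, of _ f] ext .
  show "integral {0..pi} (\<lambda>z. (Wk k x y z * \<bar>sin z\<bar> powr (2 * k)) *\<^sub>R \<phi> z) =
      (Gamma (k + 1/2) / (2 * Gamma k * sqrt pi)) *\<^sub>R integral {-1<..<1}
        (\<lambda>t. gegenbauer_weight k t *\<^sub>R \<phi> (arccos (cos x * cos y + sin x * sin y * t)))"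
    using D(2) unfolding f_def[symmetric] integral_restrict_UNIV[symmetric, of _ f] ext
    unfolding g_def u_def P_def C_def .
qed

section \<open>The average of an exponential\<close>

text \<open>The Chebyshev recurrence with a free second value: p = u gives T_n(u) and p = 2u gives
  U_n(u). With u = cos z and p = e^(iz) it produces e^(inz).\<close>

fun cheb :: "complex \<Rightarrow> complex \<Rightarrow> nat \<Rightarrow> complex" where
  "cheb u p 0 = 1"
| "cheb u p (Suc 0) = p"
| "cheb u p (Suc (Suc n)) = 2 * u * cheb u p (Suc n) - cheb u p n"

text \<open>If \<open>e\<^bsup>ijz\<^esup> = p(cos z) + sin z q(cos z)\<close>, then this is \<open>p(u) + s q(u)\<close> with
  \<open>u = cos (x + y) + r\<close>, \<open>s = sin (x + y) + ir\<close> and \<open>r = sin x sin y (1 + t)\<close>; for \<open>j = 1\<close> the two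
  contributions of \<open>r\<close> cancel, which is why positive frequencies stay triangular.\<close>

definition shift_exp :: "int \<Rightarrow> real \<Rightarrow> real \<Rightarrow> real \<Rightarrow> complex" where
  "shift_exp j x y t = cheb (of_real (cos x * cos y + sin x * sin y * t))
     (if j \<ge> 0 then cis (x + y) else cis (- (x + y)) + of_real (2 * sin x * sin y * (1 + t)))
     (nat \<bar>j\<bar>)"

lemma cheb_unique:
  assumes "L 0 = b" "L 1 = b * p" "\<And>n. L (Suc (Suc n)) = 2 * u * L (Suc n) - L n"
  shows "L n = b * cheb u p n"
  proof (induction n rule: induct_nat_012)
  case (ge2 n)
  then show ?case using assms(3)[of n] by (simp add: algebra_simps)
qed (use assms in simp_all)

lemma cis_recurrence:
  "cis (real (Suc (Suc n)) * z) = 2 * of_real (cos z) * cis (real (Suc n) * z) - cis (real n * z)"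
proof -
  have "2 * of_real (cos z) = cis z + cis (- z)"
    by (simp add: complex_eq_iff)
  then show ?thesis
    by (simp add: distrib_right cis_mult algebra_simps)
qed

text \<open>Both differences of cosines carry the factor sin x sin y, which cancels against the
  denominator. The sign of z survives only in 1 / sin z, so the even and odd parts in z are
  separated.\<close>

lemma calW_factor_reduce:
  assumes nz: "sin x * sin y \<noteq> 0" and "sin z \<noteq> 0"
    and z: "cos z = cos x * cos y + sin x * sin y * t"
  shows "calW_factor x y z = of_real (1 - t) *
           (1 + Complex (sin (x + y)) (sin x * sin y * (1 + t)) / of_real (sin z))"
proof -
  define P where "P = sin x * sin y"
  have 1: "cos (x - y) - cos z = P * (1 - t)" "cos z - cos (x + y) = P * (1 + t)"
    by (simp_all add: z P_def cos_add cos_diff algebra_simps)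
  have "calW_factor x y z = of_real (P * (1 - t) / (P * sin z)) * Complex (sin (x + y) + sin z) (P * (1 + t))"
    unfolding calW_factor_def 1 P_def[symmetric] ..
  also have "P * (1 - t) / (P * sin z) = (1 - t) / sin z"
    using nz by (simp add: P_def)
  also have "of_real ((1 - t) / sin z) * Complex (sin (x + y) + sin z) (P * (1 + t)) =
      of_real (1 - t) * ((of_real (sin z) + Complex (sin (x + y)) (P * (1 + t))) / of_real (sin z))"
    by (simp add: complex_eq_iff add.commute)
  also have "\<dots> = of_real (1 - t) * (1 + Complex (sin (x + y)) (P * (1 + t)) / of_real (sin z))"
    using assms(2) by (simp add: add_divide_distrib)
  finally show ?thesis unfolding P_def .
qed

text \<open>The contributions of z and -z are added because they belong to the same t. As a sequence
  in |j| the left side obeys the Chebyshev recurrence for cos z, so for either sign of j it is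
  determined by its values at |j| = 0 and |j| = 1.\<close>

lemma calW_factor_exp:
  assumes nz: "sin x * sin y \<noteq> 0" and "sin z \<noteq> 0"
    and z: "cos z = cos x * cos y + sin x * sin y * t"
  shows "cis (of_int j * z) * calW_factor x y z + cis (- (of_int j * z)) * calW_factor x y (- z) =
           of_real (2 * (1 - t)) * shift_exp j x y t"
proof -
  define r where "r = sin x * sin y * (1 + t)"
  define s where "s = Complex (sin (x + y)) r"
  have F: "calW_factor x y z = of_real (1 - t) * (1 + s / of_real (sin z))"
    "calW_factor x y (- z) = of_real (1 - t) * (1 - s / of_real (sin z))"
    using calW_factor_reduce[of x y z t] calW_factor_reduce[of x y "- z" t] assms
    by (simp_all add: s_def r_def)
  have cz: "cos z = cos (x + y) + r"
    by (simp add: z r_def cos_add algebra_simps)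
  define L where "L e n = cis (real n * (e * z)) * calW_factor x y z + cis (real n * (- (e * z))) * calW_factor x y (- z)"
    for e n
  have rec: "L e (Suc (Suc n)) = 2 * of_real (cos z) * L e (Suc n) - L e n" if "\<bar>e\<bar> = 1" for e n
  proof -
    have "cos (e * z) = cos z" "cos (- (e * z)) = cos z"
      using that by (auto simp: abs_if split: if_splits)
    then show ?thesis
      unfolding L_def cis_recurrence by (simp add: algebra_simps)
  qed
  have L0: "L e 0 = of_real (2 * (1 - t))" for e
    by (simp add: L_def F algebra_simps)
  \<comment> \<open>For a = z and a = -z the quotient sin a / sin z is 1 or -1, so no singular
    denominator remains.\<close>
  have key: "cis a * calW_factor x y z + cis (- a) * calW_factor x y (- z) =
      of_real (2 * (1 - t)) * (of_real (cos a) + \<i> * s * (of_real (sin a) / of_real (sin z)))" for a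
  proof -
    have "cis a * (1 + q) + cis (- a) * (1 - q) = 2 * (of_real (cos a) + \<i> * of_real (sin a) * q)" for q
      by (simp add: complex_eq_iff algebra_simps)
    moreover define q where "q = s / of_real (sin z)"
    ultimately have "of_real (1 - t) * (cis a * (1 + q) + cis (- a) * (1 - q)) =
        of_real (1 - t) * (2 * (of_real (cos a) + \<i> * of_real (sin a) * q))"
      by (simp only:)
    moreover have "\<i> * s * (of_real (sin a) / of_real (sin z)) = \<i> * of_real (sin a) * q"
      by (simp add: q_def)
    moreover have "of_real (2 * (1 - t)) = 2 * (of_real (1 - t) :: complex)"
      by simp
    ultimately show ?thesis
      unfolding F q_def[symmetric] by algebra
  qed
  have cs: "of_real (cos z) + \<i> * s = cis (x + y)"
    "of_real (cos z) - \<i> * s = cis (- (x + y)) + of_real (2 * r)"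
    unfolding cis_cnj[symmetric] by (simp_all add: complex_eq_iff s_def cz)
  have L1: "L 1 1 = of_real (2 * (1 - t)) * cis (x + y)"
    using key[of z] cs(1) assms(2) unfolding L_def by simp
  have Lm: "L (- 1) 1 = of_real (2 * (1 - t)) * (cis (- (x + y)) + of_real (2 * r))"
    using key[of "- z"] cs(2) assms(2) unfolding L_def by simp
  show ?thesis
  proof (cases "j \<ge> 0")
    case True
    have "L 1 (nat \<bar>j\<bar>) = of_real (2 * (1 - t)) * shift_exp j x y t"
      using cheb_unique[where L = "L 1", OF L0 L1 rec] True by (simp add: shift_exp_def z)
    then show ?thesis using True by (simp add: L_def)
  next
    case False
    have "L (-1) (nat \<bar>j\<bar>) = of_real (2 * (1 - t)) * shift_exp j x y t"
      using cheb_unique[where L = "L (- 1)", OF L0 Lm rec] False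
      by (simp add: shift_exp_def z r_def mult.assoc)
    then show ?thesis using False by (simp add: L_def)
  qed
qed

section \<open>Lower sets of the order on the frequencies\<close>

definition idx :: "int \<Rightarrow> int set" where
  "idx n = {j. tri j n \<or> j = n}"

lemma idx_pos: "n > 0 \<Longrightarrow> idx n = {j. - n < j \<and> j \<le> n \<and> even (n - j)}"
  unfolding idx_def tri_def by (auto simp: abs_if)

lemma idx_nonpos: "n \<le> 0 \<Longrightarrow> idx n = {j. n \<le> j \<and> j \<le> - n \<and> even (n - j)}"
  unfolding idx_def tri_def by (auto simp: abs_if)

lemma finite_idx [simp]: "finite (idx n)"
  by (rule finite_subset[of _ "{-\<bar>n\<bar>..\<bar>n\<bar>}"]) (auto simp: idx_def tri_def)

lemma finite_tri [simp]: "finite {j. tri j n}"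
  by (rule finite_subset[OF _ finite_idx[of n]]) (auto simp: idx_def)

lemma idx_eq: "idx n = insert n {j. tri j n}" and tri_irrefl: "\<not> tri n n"
  by (auto simp: idx_def tri_def)

lemma tri_parity: "tri j n \<Longrightarrow> even (\<bar>n\<bar> - \<bar>j\<bar>)"
  unfolding tri_def by (elim disjE conjE) (simp_all only: diff_self dvd_0_right)

lemma idx_parity: "j \<in> idx n \<Longrightarrow> even (\<bar>n\<bar> - \<bar>j\<bar>)"
  unfolding idx_def using tri_parity by auto

text \<open>Transitivity of the order. If an operator sends e^(ijx) into the span of
  \<open>idx j\<close> and j is below n, the image is still orthogonal to E_n.\<close>

lemma idx_subset_tri: "tri j n \<Longrightarrow> idx j \<subseteq> {i. tri i n}"
proof
  fix i assume ji: "tri j n" "i \<in> idx j"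
  then have "even (\<bar>n\<bar> - \<bar>j\<bar>)" "even (\<bar>j\<bar> - \<bar>i\<bar>)"
    using tri_parity idx_parity by blast+
  then have "even ((\<bar>n\<bar> - \<bar>j\<bar>) + (\<bar>j\<bar> - \<bar>i\<bar>))" by (rule dvd_add)
  then have "even (\<bar>n\<bar> - \<bar>i\<bar>)" by (simp only: diff_add_cancel add_diff_eq)
  moreover have "\<bar>i\<bar> < \<bar>n\<bar> \<or> \<bar>i\<bar> = \<bar>n\<bar> \<and> n < i"
    using ji unfolding idx_def tri_def mem_Collect_eq by linarith
  ultimately show "i \<in> {i. tri i n}" by (auto simp: tri_def)
qed

text \<open>The coefficients may depend on t but not on x: averaging over t then acts on each
  coefficient separately, and continuity makes these averages exist.\<close>

definition trig_family :: "int set \<Rightarrow> (real \<Rightarrow> real \<Rightarrow> complex) \<Rightarrow> bool" where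
  "trig_family S f \<longleftrightarrow> (\<exists>c. (\<forall>i. continuous_on UNIV (c i)) \<and>
     (\<forall>x t. f x t = (\<Sum>i\<in>S. c i t * cis (of_int i * x))))"

lemma trig_family_mono:
  assumes "trig_family S f" "S \<subseteq> S'" "finite S'"
  shows "trig_family S' f"
proof -
  obtain c where c: "\<And>i. continuous_on UNIV (c i)"
    "\<And>x t. f x t = (\<Sum>i\<in>S. c i t * cis (of_int i * x))"
    using assms(1) unfolding trig_family_def by blast
  have "f x t = (\<Sum>i\<in>S'. (if i \<in> S then c i t else 0) * cis (of_int i * x))" for x t
    unfolding c(2) by (rule sum.mono_neutral_cong_left) (use assms in auto)
  moreover have "continuous_on UNIV (\<lambda>t. if i \<in> S then c i t else 0)" for i
    using c(1) by (cases "i \<in> S") auto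
  ultimately show ?thesis
    unfolding trig_family_def by (intro exI[of _ "\<lambda>i t. if i \<in> S then c i t else 0"]) blast
qed

lemma trig_family_add:
  assumes "trig_family S f" "trig_family S g"
  shows "trig_family S (\<lambda>x t. f x t + g x t)"
proof -
  obtain c where c: "\<And>i. continuous_on UNIV (c i)"
    "\<And>x t. f x t = (\<Sum>i\<in>S. c i t * cis (of_int i * x))"
    using assms(1) unfolding trig_family_def by blast
  obtain d where d: "\<And>i. continuous_on UNIV (d i)"
    "\<And>x t. g x t = (\<Sum>i\<in>S. d i t * cis (of_int i * x))"
    using assms(2) unfolding trig_family_def by blast
  have "f x t + g x t = (\<Sum>i\<in>S. (c i t + d i t) * cis (of_int i * x))" for x t
    unfolding c(2) d(2) distrib_right sum.distrib ..
  moreover have "continuous_on UNIV (\<lambda>t. c i t + d i t)" for i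
    by (intro continuous_on_add c d)
  ultimately show ?thesis
    unfolding trig_family_def by (intro exI[of _ "\<lambda>i t. c i t + d i t"]) blast
qed

lemma trig_family_shift:
  assumes "trig_family S f" "continuous_on UNIV a"
  shows "trig_family ((+) m ` S) (\<lambda>x t. a t * cis (of_int m * x) * f x t)"
proof -
  obtain c where c: "\<And>i. continuous_on UNIV (c i)"
    "\<And>x t. f x t = (\<Sum>i\<in>S. c i t * cis (of_int i * x))"
    using assms(1) unfolding trig_family_def by blast
  have "a t * cis (of_int m * x) * f x t = (\<Sum>i\<in>(+) m ` S. a t * c (i - m) t * cis (of_int i * x))" for x t
    unfolding c(2) sum_distrib_left
    by (subst sum.reindex) (auto intro!: sum.cong simp: distrib_right cis_mult[symmetric])
  moreover have "continuous_on UNIV (\<lambda>t. a t * c (i - m) t)" for i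
    by (intro continuous_on_mult assms(2) c)
  ultimately show ?thesis
    unfolding trig_family_def by (intro exI[of _ "\<lambda>i t. a t * c (i - m) t"]) blast
qed

lemma trig_family_cis:
  "continuous_on UNIV a \<Longrightarrow> trig_family {m} (\<lambda>x t. a t * cis (of_int m * x))"
  unfolding trig_family_def by (intro exI[of _ "\<lambda>i. a"]) auto

text \<open>Induction along the recurrence. Multiplication by 2 (cos x cos y + t sin x sin y) shifts
  frequencies by 1 and by -1, as \<open>up\<close> and \<open>down\<close> allow; \<open>sub\<close>
  takes care of the subtracted term.\<close>

lemma trig_family_cheb:
  fixes y :: real and p :: "real \<Rightarrow> real \<Rightarrow> complex" and S :: "nat \<Rightarrow> int set"
  assumes fin: "\<And>n. finite (S n)" and S0: "0 \<in> S 0" and p: "trig_family (S 1) p"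
    and up: "\<And>n. (+) 1 ` S (Suc n) \<subseteq> S (Suc (Suc n))"
    and down: "\<And>n. (+) (- 1) ` S (Suc n) \<subseteq> S (Suc (Suc n))"
    and sub: "\<And>n. S n \<subseteq> S (Suc (Suc n))"
  shows "trig_family (S n) (\<lambda>x t. cheb (of_real (cos x * cos y + sin x * sin y * t)) (p x t) n)"
    (is "trig_family _ (?f n)")
proof (induction n rule: induct_nat_012)
  case 0
  show ?case
    using trig_family_mono[OF trig_family_cis[of "\<lambda>_. 1" 0], of "S 0"] S0 fin by simp
next
  case 1
  then show ?case using p by simp
next
  case (ge2 n)
  have 1: "trig_family (S (Suc (Suc n))) (\<lambda>x t. Complex (cos y) (- sin y * t) * cis (of_int 1 * x) * ?f (Suc n) x t)"
    by (rule trig_family_mono[OF trig_family_shift[OF ge2(2)] up fin]) (auto intro!: continuous_intros)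
  have 2: "trig_family (S (Suc (Suc n))) (\<lambda>x t. Complex (cos y) (sin y * t) * cis (of_int (- 1) * x) * ?f (Suc n) x t)"
    by (rule trig_family_mono[OF trig_family_shift[OF ge2(2)] down fin]) (auto intro!: continuous_intros)
  have "trig_family ((+) 0 ` S n) (\<lambda>x t. (- 1) * cis (of_int 0 * x) * ?f n x t)"
    by (rule trig_family_shift[OF ge2(1)]) (auto intro!: continuous_intros)
  then have 3: "trig_family (S (Suc (Suc n))) (\<lambda>x t. - ?f n x t)"
    using trig_family_mono[OF _ sub fin, of n] by simp
  have "2 * of_real (cos x * cos y + sin x * sin y * t) =
     Complex (cos y) (- sin y * t) * cis (of_int 1 * x) + Complex (cos y) (sin y * t) * cis (of_int (- 1) * x)" for x t
    by (simp add: complex_eq_iff)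
  then have "?f (Suc (Suc n)) x t =
     Complex (cos y) (- sin y * t) * cis (of_int 1 * x) * ?f (Suc n) x t +
     Complex (cos y) (sin y * t) * cis (of_int (- 1) * x) * ?f (Suc n) x t + (- ?f n x t)" for x t
    by (simp only: cheb.simps distrib_right diff_conv_add_uminus)
  then show ?case
    using trig_family_add[OF trig_family_add[OF 1 2] 3] by presburger
qed

text \<open>The triangularity. For j \<ge> 0 the recurrence starts in \<open>idx 0\<close> = {0} and
  \<open>idx 1\<close> = {1}, the latter because its second value is the single exponential e^(i(x +
  y)). For j < 0 it starts in {0} and \<open>idx (- 1)\<close> = {-1, 1}, where sin x contributes
  both frequencies.\<close>

lemma trig_family_shift_exp: "trig_family (idx j) (\<lambda>x t. shift_exp j x y t)"
proof (cases "j \<ge> 0")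
  case True
  have "trig_family (idx (int (nat \<bar>j\<bar>)))
     (\<lambda>x t. cheb (of_real (cos x * cos y + sin x * sin y * t)) (cis (x + y)) (nat \<bar>j\<bar>))"
  proof (rule trig_family_cheb[where S = "\<lambda>n. idx (int n)"])
    show "trig_family (idx (int 1)) (\<lambda>x t. cis (x + y))"
      using trig_family_mono[OF trig_family_cis[of "\<lambda>_. cis y" 1], of "idx (int 1)"]
      by (simp add: idx_def cis_mult add.commute)
    show "(+) 1 ` idx (int (Suc n)) \<subseteq> idx (int (Suc (Suc n)))"
      "(+) (- 1) ` idx (int (Suc n)) \<subseteq> idx (int (Suc (Suc n)))" for n
      by (auto simp: idx_pos)
    show "idx (int n) \<subseteq> idx (int (Suc (Suc n)))" for n
      by (auto simp: idx_def tri_def)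
  qed (simp_all add: idx_def)
  then show ?thesis using True by (simp add: shift_exp_def)
next
  case False
  have "trig_family (idx (- int (nat \<bar>j\<bar>)))
     (\<lambda>x t. cheb (of_real (cos x * cos y + sin x * sin y * t))
       (cis (- (x + y)) + of_real (2 * sin x * sin y * (1 + t))) (nat \<bar>j\<bar>))"
  proof (rule trig_family_cheb[where S = "\<lambda>n. idx (- int n)"])
    have "cis (- (x + y)) + of_real (2 * sin x * sin y * (1 + t)) =
       Complex 0 (- sin y * (1 + t)) * cis (of_int 1 * x) +
       Complex (cos y) (sin y * t) * cis (of_int (- 1) * x)" for x t
      unfolding cis_cnj[symmetric] by (simp add: complex_eq_iff cos_add sin_add algebra_simps)
    moreover have "trig_family (idx (- int 1)) (\<lambda>x t. Complex 0 (- sin y * (1 + t)) * cis (of_int 1 * x))"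
      "trig_family (idx (- int 1)) (\<lambda>x t. Complex (cos y) (sin y * t) * cis (of_int (- 1) * x))"
      by (rule trig_family_mono[OF trig_family_cis]; (simp add: idx_nonpos; fail)?;
          (intro finite_idx)?; (intro continuous_intros)?)+
    ultimately show "trig_family (idx (- int 1)) (\<lambda>x t. cis (- (x + y)) + of_real (2 * sin x * sin y * (1 + t)))"
      using trig_family_add by presburger
    show "(+) 1 ` idx (- int (Suc n)) \<subseteq> idx (- int (Suc (Suc n)))"
      "(+) (- 1) ` idx (- int (Suc n)) \<subseteq> idx (- int (Suc (Suc n)))"
      "idx (- int n) \<subseteq> idx (- int (Suc (Suc n)))" for n
      by (auto simp: idx_nonpos)
  qed (simp_all add: idx_def)
  then show ?thesis using False by (simp add: shift_exp_def)
qed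

text \<open>At x = 0 the argument is cos y and the second value is e^(iy) or e^(-iy), so t drops out
  and the recurrence is that of the exponential.\<close>

lemma shift_exp_0: "shift_exp j 0 y t = cis (of_int j * y)"
proof -
  have "cis (real n * z) = 1 * cheb (of_real (cos z)) (cis z) n" for n z
    by (rule cheb_unique) (simp_all only: cis_recurrence, simp_all)
  from this[of "nat \<bar>j\<bar>" y] this[of "nat \<bar>j\<bar>" "- y"] show ?thesis
    by (auto simp: shift_exp_def)
qed

section \<open>The generalized translation\<close>

text \<open>The operator A_y. Where sin x = 0 the denominator of the kernel vanishes and division by
  zero makes the value 0. Elsewhere on [-pi, pi] its image of E_n agrees with a trigonometric
  polynomial when sin y is nonzero, and it is that polynomial which is later evaluated at x =
  0.\<close>

definition gen_translation :: "real \<Rightarrow> real \<Rightarrow> (real \<Rightarrow> complex) \<Rightarrow> real \<Rightarrow> complex" where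
  "gen_translation k y f x = integral {-pi..pi} (\<lambda>z. f z * calW k x y z * complex_of_real (\<bar>sin z\<bar> powr (2 * k)))"

text \<open>The constant is twice the one in \<open>Wk\<close>, because z and -z correspond to the
  same t.\<close>

definition jacobi_mean :: "real \<Rightarrow> (real \<Rightarrow> complex) \<Rightarrow> complex" where
  "jacobi_mean k f = (Gamma (k + 1/2) / (Gamma k * sqrt pi)) *\<^sub>R
     integral {-1<..<1} (\<lambda>t. gegenbauer_weight k t *\<^sub>R (of_real (1 - t) * f t))"

lemma gegenbauer_weight_scaleR_integrable:
  fixes f :: "real \<Rightarrow> complex"
  assumes "k > 0" "continuous_on UNIV f"
  shows "(\<lambda>t. gegenbauer_weight k t *\<^sub>R f t) absolutely_integrable_on {-1<..<1}"
proof (rule absolutely_integrable_bounded_measurable_product[where h = "\<lambda>a b. b *\<^sub>R a"])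
  show "bilinear (\<lambda>(a::complex) b. b *\<^sub>R a)"
    by (auto simp: bilinear_def scaleR_add_left scaleR_add_right intro!: linearI)
  show "f \<in> borel_measurable (lebesgue_on {-1<..<1})"
    using assms(2) continuous_on_subset by (intro continuous_imp_measurable_on_sets_lebesgue) auto
  have "compact (f ` {-1..1})"
    using assms(2) continuous_on_subset by (intro compact_continuous_image) auto
  then show "bounded (f ` {-1<..<1})"
    by (rule bounded_subset[OF compact_imp_bounded]) auto
qed (use gegenbauer_weight_integrable[OF assms(1)] in auto)

lemma jacobi_mean_sum:
  assumes "k > 0" "\<And>i. continuous_on UNIV (c i)" "finite S"
  shows "jacobi_mean k (\<lambda>t. \<Sum>i\<in>S. c i t * a i) = (\<Sum>i\<in>S. jacobi_mean k (c i) * a i)"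
proof -
  have int: "(\<lambda>t. gegenbauer_weight k t *\<^sub>R (of_real (1 - t) * c i t)) integrable_on {-1<..<1}" for i
    by (intro set_lebesgue_integral_eq_integral(1) gegenbauer_weight_scaleR_integrable assms continuous_intros)
  have "integral {-1<..<1} (\<lambda>t. gegenbauer_weight k t *\<^sub>R (of_real (1 - t) * (\<Sum>i\<in>S. c i t * a i))) =
     integral {-1<..<1} (\<lambda>t. \<Sum>i\<in>S. (gegenbauer_weight k t *\<^sub>R (of_real (1 - t) * c i t)) * a i)"
    by (intro integral_cong) (simp add: scaleR_sum_right sum_distrib_left mult.assoc)
  also have "\<dots> = (\<Sum>i\<in>S. integral {-1<..<1} (\<lambda>t. (gegenbauer_weight k t *\<^sub>R (of_real (1 - t) * c i t)) * a i))"
    using assms(3) by (rule integral_sum) (intro integrable_on_mult_left int)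
  also have "\<dots> = (\<Sum>i\<in>S. integral {-1<..<1} (\<lambda>t. gegenbauer_weight k t *\<^sub>R (of_real (1 - t) * c i t)) * a i)"
    by (simp only: integral_mult_left)
  finally show ?thesis
    unfolding jacobi_mean_def by (simp add: scaleR_sum_right)
qed

lemma jacobi_mean_const:
  assumes "k > 0"
  shows "jacobi_mean k (\<lambda>_. a) = a"
proof -
  have "(\<lambda>t. (1 - t) * gegenbauer_weight k t) integrable_on {-1<..<1}"
  proof (rule integrable_eq)
    show "(\<lambda>t. (1 - t) powr (k + 1 - 1) * (1 + t) powr (k - 1)) integrable_on {-1<..<1}"
      using assms by (intro has_integral_integrable[OF has_integral_jacobi_weight]) auto
  qed (simp only: gegenbauer_weight_eq(2))
  then have "((\<lambda>t. complex_of_real ((1 - t) * gegenbauer_weight k t)) has_integral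
      of_real (Gamma k * sqrt pi / Gamma (k + 1/2))) {-1<..<1}"
    unfolding integral_one_minus_gegenbauer_weight[OF assms, symmetric]
    by (intro has_integral_of_real integrable_integral)
  then have "((\<lambda>t. complex_of_real ((1 - t) * gegenbauer_weight k t) * a) has_integral
      of_real (Gamma k * sqrt pi / Gamma (k + 1/2)) * a) {-1<..<1}"
    by (rule has_integral_mult_left)
  then have "integral {-1<..<1} (\<lambda>t. gegenbauer_weight k t *\<^sub>R (of_real (1 - t) * a)) =
      of_real (Gamma k * sqrt pi / Gamma (k + 1/2)) * a"
    by (intro integral_unique) (simp add: scaleR_conv_of_real mult_ac)
  moreover have "Gamma k > 0" "Gamma (k + 1/2) > 0"
    using assms by (simp_all add: Gamma_real_pos)
  ultimately show ?thesis
    by (simp add: jacobi_mean_def scaleR_conv_of_real)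
qed

lemma shift_exp_mean_expansion:
  assumes "k > 0"
  obtains a where "\<And>x. jacobi_mean k (shift_exp j x y) = (\<Sum>i\<in>idx j. a i * cis (of_int i * x))"
proof -
  obtain c where c: "\<And>i. continuous_on UNIV (c i)"
    "\<And>x t. shift_exp j x y t = (\<Sum>i\<in>idx j. c i t * cis (of_int i * x))"
    using trig_family_shift_exp[of j y] unfolding trig_family_def by blast
  have "jacobi_mean k (shift_exp j x y) = (\<Sum>i\<in>idx j. jacobi_mean k (c i) * cis (of_int i * x))" for x
    using jacobi_mean_sum[where c = c, OF assms c(1) finite_idx, of "\<lambda>i. cis (of_int i * x)" j]
    by (simp add: c(2)[abs_def])
  then show ?thesis by (rule that)
qed

lemma continuous_shift_exp: "continuous_on UNIV (shift_exp j x y)"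
proof -
  obtain c where c: "\<And>i. continuous_on UNIV (c i)"
    "\<And>x t. shift_exp j x y t = (\<Sum>i\<in>idx j. c i t * cis (of_int i * x))"
    using trig_family_shift_exp[of j y] unfolding trig_family_def by blast
  show ?thesis
    unfolding c(2)[abs_def] by (intro continuous_on_sum continuous_on_mult c continuous_on_const)
qed

lemma integral_symmetric_interval:
  fixes f :: "real \<Rightarrow> 'a :: euclidean_space"
  assumes "f integrable_on {-a..a}" "0 \<le> a"
  shows "integral {-a..a} f = integral {0..a} (\<lambda>z. f z + f (- z))"
proof -
  have 1: "f integrable_on {0..a}" "f integrable_on {-a..0}"
    using assms by (auto intro: integrable_on_subinterval)
  have 2: "(\<lambda>z. f (- z)) integrable_on {0..a}" "integral {0..a} (\<lambda>z. f (- z)) = integral {-a..0} f"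
    using 1(2) Henstock_Kurzweil_Integration.integrable_reflect_real[where f = f and a = "-a" and b = 0]
      Henstock_Kurzweil_Integration.integral_reflect_real[where f = f and a = "-a" and b = 0]
    by simp_all
  show ?thesis
    using Henstock_Kurzweil_Integration.integral_combine[of "-a" 0 a f] assms 1 2
    by (simp add: Henstock_Kurzweil_Integration.integral_add add.commute)
qed

section \<open>Positivity, measurability and integrability of the kernel\<close>

lemma Wk_nonneg: "k > 0 \<Longrightarrow> Wk k x y z \<ge> 0"
  unfolding Wk_def by (auto intro!: divide_nonneg_nonneg mult_nonneg_nonneg Gamma_real_nonneg simp: Gamma_real_pos less_imp_le)

text \<open>Both variables are functions of one point p, so that the rule also yields joint
  measurability in (x, z), as Fubini requires.\<close>

lemma Wk_measurable [measurable]: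
  fixes f g :: "'a \<Rightarrow> real"
  assumes [measurable]: "f \<in> borel_measurable M" "g \<in> borel_measurable M"
  shows "(\<lambda>p. Wk k (f p) y (g p)) \<in> borel_measurable M"
  unfolding Wk_def by measurable

lemma calW_measurable [measurable]:
  fixes f g :: "'a \<Rightarrow> real"
  assumes [measurable]: "f \<in> borel_measurable M" "g \<in> borel_measurable M"
  shows "(\<lambda>p. calW k (f p) y (g p)) \<in> borel_measurable M"
  unfolding calW_def by measurable

text \<open>The substitution applied to the constant 1. The value of the integral depends on neither
  x nor y, and this uniformity supplies the row bound in
  \<open>gen_translation_adjoint\<close>.\<close>

lemma Wk_set_integrable:
  assumes "k > 0" "\<bar>x\<bar> \<le> pi" "\<bar>y\<bar> \<le> pi" "sin x * sin y \<noteq> 0"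
  shows "set_integrable lborel {-pi..pi} (\<lambda>z. Wk k x y z * \<bar>sin z\<bar> powr (2 * k))"
    and "(LINT z : {-pi..pi} | lborel. Wk k x y z * \<bar>sin z\<bar> powr (2 * k)) =
      Gamma (k + 1/2) / (Gamma k * sqrt pi) * integral {-1<..<1} (gegenbauer_weight k)"
proof -
  let ?w = "\<lambda>z. Wk k x y z * \<bar>sin z\<bar> powr (2 * k)"
  have even: "?w (- z) = ?w z" for z
    by (simp add: Wk_def)
  have 1: "?w absolutely_integrable_on {0..pi}"
    and 2: "integral {0..pi} ?w = Gamma (k + 1/2) / (2 * Gamma k * sqrt pi) * integral {-1<..<1} (gegenbauer_weight k)"
    using arccos_substitution[OF assms(2-4), of k "\<lambda>_. 1 :: real"] gegenbauer_weight_integrable[OF assms(1)]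
    by simp_all
  have "?w absolutely_integrable_on {-pi..0}"
    using 1 absolutely_integrable_reflect_real[where f = ?w and a = 0 and b = pi]
    by (simp only: even minus_zero)
  then have "?w absolutely_integrable_on ({-pi..0} \<union> {0..pi})"
    using 1 by (rule absolutely_integrable_Un)
  also have "{-pi..0} \<union> {0..pi} = {-pi..pi}"
    by auto
  finally have 3: "?w absolutely_integrable_on {-pi..pi}" .
  \<comment> \<open>The substitution speaks of Lebesgue measure; Borel measurability of the
    integrand allows the passage to \<open>lborel\<close>, where Fubini is applied.\<close>
  then show 4: "set_integrable lborel {-pi..pi} ?w"
    unfolding set_integrable_def by (subst (asm) integrable_completion) auto
  have "integral {-pi..pi} ?w = integral {0..pi} (\<lambda>z. ?w z + ?w (- z))"
    using set_lebesgue_integral_eq_integral(1)[OF 3] by (rule integral_symmetric_interval) auto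
  also have "\<dots> = integral {0..pi} (\<lambda>z. 2 * ?w z)"
  proof (rule integral_cong)
    show "?w z + ?w (- z) = 2 * ?w z" for z
      unfolding even by simp
  qed
  also have "\<dots> = 2 * integral {0..pi} ?w"
    by (rule integral_mult_right)
  finally show "(LINT z : {-pi..pi} | lborel. ?w z) =
      Gamma (k + 1/2) / (Gamma k * sqrt pi) * integral {-1<..<1} (gegenbauer_weight k)"
    using set_borel_integral_eq_integral(2)[OF 4] 2 by simp
qed

lemma calW_set_integrable:
  fixes f :: "real \<Rightarrow> complex"
  assumes "k > 0" "\<bar>x\<bar> \<le> pi" "\<bar>y\<bar> \<le> pi" "sin x * sin y \<noteq> 0" "continuous_on UNIV f"
  shows "set_integrable lborel {-pi..pi} (\<lambda>z. f z * calW k x y z * complex_of_real (\<bar>sin z\<bar> powr (2 * k)))"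
proof -
  have [measurable]: "f \<in> borel_measurable borel"
    using assms(5) by (rule borel_measurable_continuous_onI)
  have "compact (f ` {-pi..pi})"
    using assms(5) continuous_on_subset by (intro compact_continuous_image) auto
  then obtain B where B: "\<And>z. z \<in> {-pi..pi} \<Longrightarrow> cmod (f z) \<le> B"
    by (meson bounded_iff compact_imp_bounded image_eqI)
  have "set_integrable lborel {-pi..pi} (\<lambda>z. (B * 5) * (Wk k x y z * \<bar>sin z\<bar> powr (2 * k)))"
    by (intro set_integrable_mult_right Wk_set_integrable assms)
  then show ?thesis
    unfolding set_integrable_def
  proof (rule Bochner_Integration.integrable_bound)
    show "AE z in lborel. norm (indicat_real {- pi..pi} z *\<^sub>R (f z * calW k x y z * complex_of_real (\<bar>sin z\<bar> powr (2 * k))))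
      \<le> norm (indicat_real {- pi..pi} z *\<^sub>R (B * 5 * (Wk k x y z * \<bar>sin z\<bar> powr (2 * k))))"
    proof (intro AE_I2)
      fix z :: real
      show "norm (indicat_real {- pi..pi} z *\<^sub>R (f z * calW k x y z * complex_of_real (\<bar>sin z\<bar> powr (2 * k))))
        \<le> norm (indicat_real {- pi..pi} z *\<^sub>R (B * 5 * (Wk k x y z * \<bar>sin z\<bar> powr (2 * k))))"
      proof (cases "z \<in> {-pi..pi}")
        case True
        have "cmod (f z) * cmod (calW k x y z) * \<bar>sin z\<bar> powr (2 * k) \<le> \<bar>B\<bar> * (5 * \<bar>Wk k x y z\<bar>) * \<bar>sin z\<bar> powr (2 * k)"
          using True B[OF True] assms norm_calW_le[of x y k z]
          by (intro mult_right_mono mult_mono) (auto simp: abs_le_iff)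
        then show ?thesis using True by (simp add: norm_mult abs_mult mult.assoc)
      qed simp
    qed
  qed measurable
qed

text \<open>[-pi, pi] is folded onto [0, pi], the substitution replaces z by t, and
  \<open>calW_factor_exp\<close> evaluates the folded integrand. The resulting expression also makes
  sense where sin x = 0.\<close>

lemma gen_translation_cis:
  assumes "k > 0" "\<bar>x\<bar> \<le> pi" "\<bar>y\<bar> \<le> pi" "sin x * sin y \<noteq> 0"
  shows "gen_translation k y (\<lambda>z. cis (of_int j * z)) x = jacobi_mean k (shift_exp j x y)"
proof -
  let ?F = "\<lambda>z. cis (of_int j * z) * calW k x y z * complex_of_real (\<bar>sin z\<bar> powr (2 * k))"
  define \<phi> where "\<phi> z = cis (of_int j * z) * calW_factor x y z + cis (- (of_int j * z)) * calW_factor x y (- z)" for z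
  have sub: "gegenbauer_weight k t *\<^sub>R \<phi> (arccos (cos x * cos y + sin x * sin y * t)) =
      2 *\<^sub>R (gegenbauer_weight k t *\<^sub>R (of_real (1 - t) * shift_exp j x y t))" if "t \<in> {-1<..<1}" for t
  proof -
    have *: "\<bar>cos x * cos y + sin x * sin y * t\<bar> < 1"
      using cos_combination_less_1[OF assms(4)] that by auto
    then have "sin (arccos (cos x * cos y + sin x * sin y * t)) \<noteq> 0"
      by (subst sin_arccos_abs) (auto simp: abs_square_eq_1 abs_less_iff power2_eq_1_iff)
    with * have "\<phi> (arccos (cos x * cos y + sin x * sin y * t)) = of_real (2 * (1 - t)) * shift_exp j x y t"
      unfolding \<phi>_def by (intro calW_factor_exp assms cos_arccos_abs) auto
    then show ?thesis by (simp add: scaleR_conv_of_real)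
  qed
  have int0: "(\<lambda>t. 2 *\<^sub>R (gegenbauer_weight k t *\<^sub>R (of_real (1 - t) * shift_exp j x y t)))
      absolutely_integrable_on {-1<..<1}"
    by (intro absolutely_integrable_scaleR_left gegenbauer_weight_scaleR_integrable assms
        continuous_intros continuous_shift_exp)
  have int: "(\<lambda>t. gegenbauer_weight k t *\<^sub>R \<phi> (arccos (cos x * cos y + sin x * sin y * t)))
      absolutely_integrable_on {-1<..<1}"
    by (rule absolutely_integrable_spike[OF int0, of "{}"]) (use sub in auto)
  have "?F integrable_on {-pi..pi}"
    by (intro set_borel_integral_eq_integral(1) calW_set_integrable assms continuous_intros)
  then have "gen_translation k y (\<lambda>z. cis (of_int j * z)) x = integral {0..pi} (\<lambda>z. ?F z + ?F (- z))"
    unfolding gen_translation_def by (rule integral_symmetric_interval) auto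
  also have "\<dots> = integral {0..pi} (\<lambda>z. (Wk k x y z * \<bar>sin z\<bar> powr (2 * k)) *\<^sub>R \<phi> z)"
  proof (rule integral_cong)
    fix z
    have "Wk k x y (- z) = Wk k x y z" by (simp add: Wk_def)
    then show "?F z + ?F (- z) = (Wk k x y z * \<bar>sin z\<bar> powr (2 * k)) *\<^sub>R \<phi> z"
      by (simp add: calW_eq \<phi>_def scaleR_conv_of_real algebra_simps)
  qed
  also have "\<dots> = (Gamma (k + 1/2) / (2 * Gamma k * sqrt pi)) *\<^sub>R integral {-1<..<1}
        (\<lambda>t. gegenbauer_weight k t *\<^sub>R \<phi> (arccos (cos x * cos y + sin x * sin y * t)))"
    by (rule arccos_substitution(2)[OF assms(2-4) int])
  also have "integral {-1<..<1} (\<lambda>t. gegenbauer_weight k t *\<^sub>R \<phi> (arccos (cos x * cos y + sin x * sin y * t))) =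
     integral {-1<..<1} (\<lambda>t. 2 *\<^sub>R (gegenbauer_weight k t *\<^sub>R (of_real (1 - t) * shift_exp j x y t)))"
    by (intro integral_cong sub)
  also have "\<dots> = 2 *\<^sub>R integral {-1<..<1} (\<lambda>t. gegenbauer_weight k t *\<^sub>R (of_real (1 - t) * shift_exp j x y t))"
    by (rule integral_cmul)
  finally show ?thesis
    by (simp add: jacobi_mean_def)
qed

text \<open>Fubini for the kernel times both weights. By \<open>calW_swap\<close>, integrating over
  x first exchanges the roles of x and z and replaces y by -y.\<close>

lemma gen_translation_adjoint:
  fixes f g :: "real \<Rightarrow> complex"
  assumes k: "k > 0" and y: "\<bar>y\<bar> \<le> pi" "sin y \<noteq> 0"
    and f: "continuous_on UNIV f" and g: "continuous_on UNIV g"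
  shows "ip k (gen_translation k y f) g = ip k f (gen_translation k (- y) g)"
proof -
  let ?I = "{-pi..pi}"
  define m where "m z = \<bar>sin z\<bar> powr (2 * k)" for z
  define K where "K x z = (indicat_real ?I x * indicat_real ?I z) *\<^sub>R
      (f z * cnj (g x) * calW k x y z * of_real (m z) * of_real (m x))" for x z
  have [measurable]: "f \<in> borel_measurable borel" "g \<in> borel_measurable borel" "cnj \<in> borel_measurable borel"
    using f g by (auto intro!: borel_measurable_continuous_onI continuous_intros)
  have m_meas [measurable]: "m \<in> borel_measurable borel"
    unfolding m_def by measurable
  \<comment> \<open>Hence \<open>K\<close> vanishes where sin x = 0 or sin z = 0, which is where
    integrability of the kernel has not been established.\<close>
  have m0: "m z = 0" if "sin z = 0" for z
    using that by (simp add: m_def)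
  have m1: "0 \<le> m z" "m z \<le> 1" for z
    using k by (auto simp: m_def powr_le1)
  have bdd: "\<exists>B\<ge>0. \<forall>z\<in>?I. cmod (h z) \<le> B" if "continuous_on UNIV h" for h :: "real \<Rightarrow> complex"
  proof -
    have "compact (h ` ?I)"
      using that continuous_on_subset by (intro compact_continuous_image) auto
    then obtain B where "\<forall>z\<in>?I. cmod (h z) \<le> B"
      by (meson bounded_iff compact_imp_bounded image_eqI)
    then show ?thesis by (intro exI[of _ "max 0 B"]) auto
  qed
  obtain Bf where Bf: "Bf \<ge> 0" "\<And>z. z \<in> ?I \<Longrightarrow> cmod (f z) \<le> Bf" using bdd[OF f] by blast
  obtain Bg where Bg: "Bg \<ge> 0" "\<And>z. z \<in> ?I \<Longrightarrow> cmod (g z) \<le> Bg" using bdd[OF g] by blast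
  define M where "M = Gamma (k + 1/2) / (Gamma k * sqrt pi) * integral {-1<..<1} (gegenbauer_weight k)"
  \<comment> \<open>The integrals of |K| over z are bounded by a constant independent of x; since x
    ranges over a bounded interval, \<open>K\<close> is integrable on the plane.\<close>
  have row: "integrable lborel (K x)"
    "(\<integral>z. K x z \<partial>lborel) = indicat_real ?I x *\<^sub>R (gen_translation k y f x * cnj (g x) * of_real (m x))"
    "(\<integral>z. norm (K x z) \<partial>lborel) \<le> indicat_real ?I x * (Bf * Bg * 5 * M)" for x
  proof (atomize (full), cases "x \<in> ?I \<and> sin x \<noteq> 0")
    case False
    have M0: "M \<ge> 0"
      unfolding M_def using k by (intro mult_nonneg_nonneg integral_nonneg)
        (auto simp: gegenbauer_weight_nonneg Gamma_real_pos less_imp_le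
          intro!: set_lebesgue_integral_eq_integral(1) gegenbauer_weight_integrable divide_nonneg_nonneg)
    have "K x = (\<lambda>_. 0)"
      using False by (auto simp: K_def fun_eq_iff m0)
    then show "integrable lborel (K x) \<and>
      (\<integral>z. K x z \<partial>lborel) = indicat_real ?I x *\<^sub>R (gen_translation k y f x * cnj (g x) * of_real (m x)) \<and>
      (\<integral>z. norm (K x z) \<partial>lborel) \<le> indicat_real ?I x * (Bf * Bg * 5 * M)"
      using False M0 Bf Bg by (auto simp: m0)
  next
    case True
    then have x: "x \<in> ?I" "sin x \<noteq> 0" by auto
    have ax: "\<bar>x\<bar> \<le> pi" "sin x * sin y \<noteq> 0" using x y by auto
    have si: "set_integrable lborel ?I (\<lambda>z. f z * calW k x y z * of_real (m z))"
      unfolding m_def by (intro calW_set_integrable k ax y f)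
    have K: "K x = (\<lambda>z. (indicat_real ?I z *\<^sub>R (f z * calW k x y z * of_real (m z))) * (cnj (g x) * of_real (m x)))"
      using x by (auto simp: K_def fun_eq_iff mult_ac)
    have 1: "integrable lborel (K x)"
      unfolding K using si unfolding set_integrable_def by (rule integrable_mult_left)
    have 2: "(\<integral>z. K x z \<partial>lborel) = indicat_real ?I x *\<^sub>R (gen_translation k y f x * cnj (g x) * of_real (m x))"
      unfolding K Bochner_Integration.integral_mult_left_zero
      using set_borel_integral_eq_integral(2)[OF si] x
      by (simp add: set_lebesgue_integral_def gen_translation_def m_def mult.assoc)
    have wi: "set_integrable lborel ?I (\<lambda>z. Wk k x y z * m z)"
      unfolding m_def by (intro Wk_set_integrable k ax y)
    have "(\<integral>z. norm (K x z) \<partial>lborel) \<le> (\<integral>z. (Bf * Bg * 5) * (indicat_real ?I z *\<^sub>R (Wk k x y z * m z)) \<partial>lborel)"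
    proof (rule Bochner_Integration.integral_mono')
      show "integrable lborel (\<lambda>z. (Bf * Bg * 5) * (indicat_real ?I z *\<^sub>R (Wk k x y z * m z)))"
        using wi unfolding set_integrable_def by (rule integrable_mult_right)
      fix z :: real
      have W: "Wk k x y z \<ge> 0" by (rule Wk_nonneg[OF k])
      show "0 \<le> (Bf * Bg * 5) * (indicat_real ?I z *\<^sub>R (Wk k x y z * m z))"
        using Bf Bg W m1 by simp
      show "norm (K x z) \<le> (Bf * Bg * 5) * (indicat_real ?I z *\<^sub>R (Wk k x y z * m z))"
      proof (cases "z \<in> ?I")
        case True
        have "norm (K x z) = cmod (f z) * cmod (g x) * cmod (calW k x y z) * m z * m x"
          using True x m1 by (simp add: K_def norm_mult)
        also have "\<dots> \<le> Bf * Bg * (5 * Wk k x y z) * m z * 1"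
          using norm_calW_le[OF ax(1) y(1), of k z] True W Bf Bg x m1
          by (intro mult_mono) (auto simp: abs_le_iff)
        finally show ?thesis using True by (simp add: mult_ac)
      qed (simp add: K_def)
    qed
    also have "\<dots> = Bf * Bg * 5 * M"
      unfolding M_def Wk_set_integrable(2)[OF k ax(1) y(1) ax(2), symmetric] m_def
      by (simp add: set_lebesgue_integral_def)
    finally have "(\<integral>z. norm (K x z) \<partial>lborel) \<le> indicat_real ?I x * (Bf * Bg * 5 * M)"
      using x by simp
    with 1 2 show "integrable lborel (K x) \<and>
      (\<integral>z. K x z \<partial>lborel) = indicat_real ?I x *\<^sub>R (gen_translation k y f x * cnj (g x) * of_real (m x)) \<and>
      (\<integral>z. norm (K x z) \<partial>lborel) \<le> indicat_real ?I x * (Bf * Bg * 5 * M)"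
      by blast
  qed
  have col: "(\<integral>x. K x z \<partial>lborel) = indicat_real ?I z *\<^sub>R (f z * cnj (gen_translation k (- y) g z) * of_real (m z))" for z
  proof (cases "z \<in> ?I \<and> sin z \<noteq> 0")
    case False
    then show ?thesis by (auto simp: K_def[abs_def] m0)
  next
    case True
    then have az: "\<bar>z\<bar> \<le> pi" "sin z * sin (- y) \<noteq> 0" "\<bar>- y\<bar> \<le> pi" using y by auto
    have si: "set_integrable lborel ?I (\<lambda>x. g x * calW k z (- y) x * of_real (m x))"
      unfolding m_def by (intro calW_set_integrable k az g)
    have "K x z = cnj (indicat_real ?I x *\<^sub>R (g x * calW k z (- y) x * of_real (m x))) * (f z * of_real (m z))" for x
    proof (cases "x \<in> ?I")
      case xI: True
      have "cnj (calW k z (- y) x) = calW k x y z"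
        using xI True y by (intro calW_swap) auto
      then show ?thesis using xI True by (simp add: K_def mult_ac)
    qed (simp add: K_def)
    then have "(\<integral>x. K x z \<partial>lborel) = cnj (\<integral>x. indicat_real ?I x *\<^sub>R (g x * calW k z (- y) x * of_real (m x)) \<partial>lborel) * (f z * of_real (m z))"
      by (simp only: Bochner_Integration.integral_mult_left_zero Bochner_Integration.integral_cnj)
    then show ?thesis
      using set_borel_integral_eq_integral(2)[OF si] True
      by (simp add: set_lebesgue_integral_def gen_translation_def m_def mult_ac)
  qed
  have K_meas: "case_prod K \<in> borel_measurable (lborel \<Otimes>\<^sub>M lborel)"
    unfolding K_def by measurable
  have int: "integrable (lborel \<Otimes>\<^sub>M lborel) (case_prod K)"
  proof (rule lborel_pair.Fubini_integrable[OF K_meas])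
    show "integrable lborel (\<lambda>x. \<integral>z. norm (case_prod K (x, z)) \<partial>lborel)"
    proof (rule Bochner_Integration.integrable_bound)
      show "integrable lborel (\<lambda>x. indicat_real ?I x * (Bf * Bg * 5 * M))"
        by (intro integrable_mult_left) (auto simp: integrable_indicator_iff)
      show "(\<lambda>x. \<integral>z. norm (case_prod K (x, z)) \<partial>lborel) \<in> borel_measurable lborel"
        using K_meas by measurable
      show "AE x in lborel. norm (\<integral>z. norm (case_prod K (x, z)) \<partial>lborel) \<le> norm (indicat_real ?I x * (Bf * Bg * 5 * M))"
        using row(3) by (intro AE_I2) (simp add: order_trans[OF _ abs_ge_self])
    qed
  qed (simp add: row(1))
  have int1: "integrable lborel (\<lambda>x. \<integral>z. K x z \<partial>lborel)"
    using lborel_pair.integrable_fst'[OF int] by simp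
  have int2: "integrable lborel (\<lambda>z. \<integral>x. K x z \<partial>lborel)"
    by (rule lborel_pair.integrable_snd[OF int])
  have "ip k (gen_translation k y f) g = (\<integral>x. \<integral>z. K x z \<partial>lborel \<partial>lborel)"
    using set_borel_integral_eq_integral(2)[of ?I "\<lambda>x. gen_translation k y f x * cnj (g x) * of_real (m x)"] int1
    unfolding row(2) set_integrable_def set_lebesgue_integral_def ip_def m_def by simp
  also have "\<dots> = (\<integral>z. \<integral>x. K x z \<partial>lborel \<partial>lborel)"
    by (rule lborel_pair.Fubini_integral[OF int, symmetric])
  also have "\<dots> = ip k f (gen_translation k (- y) g)"
    using set_borel_integral_eq_integral(2)[of ?I "\<lambda>z. f z * cnj (gen_translation k (- y) g z) * of_real (m z)"] int2
    unfolding col set_integrable_def set_lebesgue_integral_def ip_def m_def by simp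
  finally show ?thesis .
qed

section \<open>Orthogonal trigonometric polynomials\<close>

text \<open>For a square system uniqueness implies solvability, shown by adding one index at a time.
  Nondegeneracy is assumed on every finite index set because each stage of the induction uses it on
  its own set.\<close>

lemma nondegenerate_system_solvable:
  fixes b :: "'a \<Rightarrow> 'a \<Rightarrow> 'b :: field"
  assumes nd: "\<And>S c i. finite S \<Longrightarrow> (\<And>i. i \<in> S \<Longrightarrow> (\<Sum>j\<in>S. c j * b j i) = 0) \<Longrightarrow> i \<in> S \<Longrightarrow> c i = 0"
    and "finite S"
  shows "\<exists>c. \<forall>i\<in>S. h i + (\<Sum>j\<in>S. c j * b j i) = 0"
  using \<open>finite S\<close>
proof (induction S arbitrary: h rule: finite_induct)
  case (insert a S)
  obtain c where c: "\<And>i. i \<in> S \<Longrightarrow> h i + (\<Sum>j\<in>S. c j * b j i) = 0"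
    using insert.IH[of h] by blast
  obtain d where d: "\<And>i. i \<in> S \<Longrightarrow> b a i + (\<Sum>j\<in>S. d j * b j i) = 0"
    using insert.IH[of "b a"] by blast
  \<comment> \<open>Row a corrected by rows from \<open>S\<close> so that it vanishes on
    \<open>S\<close>. The remaining entry \<open>D a\<close> is a Schur complement; if it were 0,
    the corrected row would be a nontrivial dependence.\<close>
  define D where "D i = b a i + (\<Sum>j\<in>S. d j * b j i)" for i
  have sum_upd: "(\<Sum>j\<in>insert a S. (if j = a then u else v j) * b j i) = u * b a i + (\<Sum>j\<in>S. v j * b j i)" for u v i
    using insert.hyps by (auto intro!: sum.cong)
  have "D a \<noteq> 0"
  proof
    assume "D a = 0"
    then have "D i = 0" if "i \<in> insert a S" for i
      using that d by (auto simp: D_def)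
    then have "(\<Sum>j\<in>insert a S. (if j = a then 1 else d j) * b j i) = 0" if "i \<in> insert a S" for i
      using that unfolding sum_upd D_def by simp
    then show False
      using nd[of "insert a S" "\<lambda>j. if j = a then 1 else d j" a] insert.hyps by simp
  qed
  \<comment> \<open>Chosen to satisfy the equation at a; the equations on \<open>S\<close> persist
    because \<open>D\<close> vanishes there.\<close>
  define \<mu> where "\<mu> = - (h a + (\<Sum>j\<in>S. c j * b j a)) / D a"
  have "h i + (\<Sum>j\<in>insert a S. (if j = a then \<mu> else c j + \<mu> * d j) * b j i) = 0" if i: "i \<in> insert a S" for i
  proof -
    have "h i + (\<Sum>j\<in>insert a S. (if j = a then \<mu> else c j + \<mu> * d j) * b j i) =
        (h i + (\<Sum>j\<in>S. c j * b j i)) + \<mu> * D i"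
      unfolding sum_upd D_def by (simp add: distrib_right sum.distrib sum_distrib_left algebra_simps)
    also have "\<dots> = 0"
    proof (cases "i = a")
      case True
      then show ?thesis using \<open>D a \<noteq> 0\<close> by (simp add: \<mu>_def)
    next
      case False
      then show ?thesis using i c[of i] d[of i] by (simp add: D_def)
    qed
    finally show ?thesis .
  qed
  then show ?case
    by (intro exI[of _ "\<lambda>j. if j = a then \<mu> else c j + \<mu> * d j"] ballI)
qed simp

section \<open>Trigonometric polynomials and the weighted inner product\<close>

definition trig_poly :: "int set \<Rightarrow> (int \<Rightarrow> complex) \<Rightarrow> real \<Rightarrow> complex" where
  "trig_poly S c x = (\<Sum>j\<in>S. c j * cis (of_int j * x))"

lemma continuous_trig_poly [continuous_intros]: "continuous_on A (trig_poly S c)"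
  unfolding trig_poly_def by (intro continuous_intros)

text \<open>Multiplied by e^(iNx) with N large, the sum is a polynomial in e^(ix) with infinitely
  many roots on the unit circle. On (0, pi) the map \<open>cis\<close> is injective and the weight
  is positive, so this is where vanishing can be read off from a zero norm.\<close>

lemma trig_poly_eq_0_imp:
  assumes "finite S" and z: "\<And>x. 0 < x \<Longrightarrow> x < pi \<Longrightarrow> trig_poly S c x = 0" and "i \<in> S"
  shows "c i = 0"
proof -
  obtain N :: nat where N: "\<And>j. j \<in> S \<Longrightarrow> j + int N \<ge> 0"
  proof -
    have "j + int (nat (Max ((\<lambda>j. \<bar>j\<bar>) ` S))) \<ge> 0" if "j \<in> S" for j
    proof -
      have "\<bar>j\<bar> \<le> Max ((\<lambda>j. \<bar>j\<bar>) ` S)"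
        using that assms(1) by (intro Max_ge) auto
      then show ?thesis by linarith
    qed
    then show ?thesis by (rule that)
  qed
  define p where "p = (\<Sum>j\<in>S. monom (c j) (nat (j + int N)))"
  have "poly p (cis x) = 0" if "0 < x" "x < pi" for x
  proof -
    have "poly p (cis x) = (\<Sum>j\<in>S. c j * cis (of_int j * x)) * cis (real N * x)"
      unfolding p_def poly_sum poly_monom sum_distrib_right
    proof (rule sum.cong)
      fix j assume "j \<in> S"
      then have "real (nat (j + int N)) = of_int j + real N"
        using N[of j] by simp
      then show "c j * cis x ^ nat (j + int N) = c j * cis (of_int j * x) * cis (real N * x)"
        unfolding Complex.DeMoivre by (simp only: mult.assoc cis_mult distrib_right)
    qed simp
    then show ?thesis using z[OF that] by (simp add: trig_poly_def)
  qed
  then have "cis ` {0<..<pi} \<subseteq> {w. poly p w = 0}" by auto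
  moreover have "infinite (cis ` {0<..<pi})"
  proof -
    have "inj_on cis {0<..<pi}"
      by (rule inj_onI) (auto simp: complex_eq_iff intro!: cos_inj_pi)
    then show ?thesis by (simp add: finite_image_iff infinite_Ioo)
  qed
  ultimately have "p = 0"
    using poly_roots_finite[of p] finite_subset by blast
  then have "0 = coeff p (nat (i + int N))" by simp
  also have "\<dots> = (\<Sum>j\<in>S. if j = i then c j else 0)"
    unfolding p_def coeff_sum coeff_monom
    by (intro sum.cong if_cong) (use N assms(3) in \<open>auto simp: eq_nat_nat_iff\<close>)
  also have "\<dots> = c i" using assms by simp
  finally show ?thesis by simp
qed

lemma continuous_on_abs_sin_powr:
  "k > 0 \<Longrightarrow> continuous_on A (\<lambda>x::real. \<bar>sin x\<bar> powr (2 * k))"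
  by (intro continuous_on_powr' continuous_intros) auto

lemma continuous_on_cis_int [continuous_intros]: "continuous_on A (\<lambda>x. cis (of_int j * x))"
  by (intro continuous_intros)

lemma ip_integrable:
  assumes "k > 0" "continuous_on UNIV f" "continuous_on UNIV g"
  shows "(\<lambda>x. f x * cnj (g x) * complex_of_real (\<bar>sin x\<bar> powr (2 * k))) integrable_on {-pi..pi}"
  using assms continuous_on_subset[OF assms(2)] continuous_on_subset[OF assms(3)]
  by (intro integrable_continuous_interval continuous_on_mult continuous_on_cnj continuous_on_of_real
      continuous_on_abs_sin_powr) auto

lemma ip_trig_poly_left:
  assumes "k > 0" "finite S" "continuous_on UNIV g"
  shows "ip k (trig_poly S c) g = (\<Sum>j\<in>S. c j * ip k (\<lambda>x. cis (of_int j * x)) g)"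
proof -
  have "ip k (trig_poly S c) g = integral {-pi..pi} (\<lambda>x. \<Sum>j\<in>S. c j *
      (cis (of_int j * x) * cnj (g x) * complex_of_real (\<bar>sin x\<bar> powr (2 * k))))"
    unfolding ip_def trig_poly_def by (intro integral_cong) (simp add: sum_distrib_right mult.assoc)
  also have "\<dots> = (\<Sum>j\<in>S. integral {-pi..pi} (\<lambda>x. c j *
      (cis (of_int j * x) * cnj (g x) * complex_of_real (\<bar>sin x\<bar> powr (2 * k)))))"
    by (intro integral_sum assms integrable_on_mult_right ip_integrable continuous_intros)
  also have "\<dots> = (\<Sum>j\<in>S. c j * ip k (\<lambda>x. cis (of_int j * x)) g)"
    unfolding ip_def by (simp only: integral_mult_right)
  finally show ?thesis .
qed

lemma ip_commute: "ip k g f = cnj (ip k f g)"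
  unfolding ip_def integral_cnj by (simp add: mult_ac)

lemma ip_trig_poly_right:
  assumes "k > 0" "finite S" "continuous_on UNIV f"
  shows "ip k f (trig_poly S c) = (\<Sum>j\<in>S. cnj (c j) * ip k f (\<lambda>x. cis (of_int j * x)))"
  unfolding ip_commute[of k f] ip_trig_poly_left[OF assms] by simp

text \<open>Orthogonality to all its own exponentials gives the sum norm zero. The integrand is
  continuous and nonnegative, so the sum vanishes wherever sin x is nonzero.\<close>

lemma trig_poly_orthogonal_imp:
  assumes k: "k > 0" and S: "finite S"
    and orth: "\<And>i. i \<in> S \<Longrightarrow> ip k (trig_poly S c) (\<lambda>x. cis (of_int i * x)) = 0" and "i \<in> S"
  shows "c i = 0"
proof (rule trig_poly_eq_0_imp[OF S _ \<open>i \<in> S\<close>])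
  let ?h = "\<lambda>x. (cmod (trig_poly S c x))\<^sup>2 * \<bar>sin x\<bar> powr (2 * k)"
  have cont: "continuous_on {-pi..pi} ?h"
    using k by (intro continuous_on_mult continuous_on_power continuous_on_norm continuous_trig_poly
        continuous_on_abs_sin_powr)
  have "complex_of_real (integral {-pi..pi} ?h) = ip k (trig_poly S c) (trig_poly S c)"
  proof -
    have "((\<lambda>x. complex_of_real (?h x)) has_integral of_real (integral {-pi..pi} ?h)) {-pi..pi}"
      by (intro has_integral_of_real integrable_integral integrable_continuous_interval cont)
    then show ?thesis
      unfolding ip_def of_real_mult complex_norm_square by (rule integral_unique[symmetric])
  qed
  also have "\<dots> = 0"
    using ip_trig_poly_right[OF k S continuous_trig_poly, of S c c] orth by simp
  finally have "integral {-pi..pi} ?h = 0" by simp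
  then have "\<forall>x\<in>{-pi..pi}. ?h x = 0"
    by (subst (asm) integral_eq_0_iff[OF cont]) auto
  then show "trig_poly S c x = 0" if "0 < x" "x < pi" for x
    using that sin_gt_zero[of x] by force
qed

lemma exp_i_conv_cis: "exp (of_int j * (\<i> * complex_of_real x)) = cis (of_int j * x)"
  "exp (\<i> * of_int j * complex_of_real x) = cis (of_int j * x)"
  by (simp_all add: cis_conv_exp mult_ac)

lemma Epoly_eq_trig_poly: "Epoly n c (\<i> * complex_of_real x) = trig_poly (idx n) (c(n := 1)) x"
  unfolding Epoly_def trig_poly_def idx_eq exp_i_conv_cis
  by (subst sum.insert) (auto simp: tri_irrefl intro!: sum.cong)

lemma Epoly_orthogonal_iff:
  assumes "k > 0"
  shows "ip k (\<lambda>x. Epoly n c (\<i> * of_real x)) (\<lambda>x. exp (\<i> * of_int i * of_real x)) = 0 \<longleftrightarrow>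
    ip k (\<lambda>x. cis (of_int n * x)) (\<lambda>x. cis (of_int i * x)) +
    (\<Sum>j\<in>{j. tri j n}. c j * ip k (\<lambda>x. cis (of_int j * x)) (\<lambda>x. cis (of_int i * x))) = 0"
proof -
  have "ip k (trig_poly (idx n) (c(n := 1))) (\<lambda>x. cis (of_int i * x)) =
    ip k (\<lambda>x. cis (of_int n * x)) (\<lambda>x. cis (of_int i * x)) +
    (\<Sum>j\<in>{j. tri j n}. c j * ip k (\<lambda>x. cis (of_int j * x)) (\<lambda>x. cis (of_int i * x)))"
    unfolding ip_trig_poly_left[OF assms finite_idx continuous_on_cis_int]
    unfolding idx_eq
    by (subst sum.insert) (auto simp: tri_irrefl intro!: sum.cong)
  then show ?thesis
    unfolding Epoly_eq_trig_poly exp_i_conv_cis by simp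
qed

text \<open>The definite description in \<open>coefs\<close> is justified by existence and
  uniqueness. Both follow from nondegeneracy of the Gram matrix of the exponentials; fixing c to be
  0 off the lower set makes c unique as a function on all integers.\<close>

lemma coefs_orthogonal:
  assumes k: "k > 0" and "tri i n"
  shows "ip k (trig_poly (idx n) ((coefs k n)(n := 1))) (\<lambda>x. cis (of_int i * x)) = 0"
proof -
  define b where "b j i = ip k (\<lambda>x. cis (of_int j * x)) (\<lambda>x. cis (of_int i * x))" for j i :: int
  let ?S = "{j. tri j n}"
  let ?P = "\<lambda>c. (\<forall>j. \<not> tri j n \<longrightarrow> c j = 0) \<and> (\<forall>j. tri j n \<longrightarrow>
         ip k (\<lambda>x. Epoly n c (\<i> * of_real x)) (\<lambda>x. exp (\<i> * of_int j * of_real x)) = 0)"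
  have P: "?P c \<longleftrightarrow> (\<forall>j. \<not> tri j n \<longrightarrow> c j = 0) \<and>
      (\<forall>i. tri i n \<longrightarrow> b n i + (\<Sum>j\<in>?S. c j * b j i) = 0)" for c
    unfolding Epoly_orthogonal_iff[OF k] b_def ..
  have nd: "c i = 0" if "finite S" "\<And>i. i \<in> S \<Longrightarrow> (\<Sum>j\<in>S. c j * b j i) = 0" "i \<in> S" for S c i
  proof (rule trig_poly_orthogonal_imp[OF k that(1) _ that(3)])
    fix i assume "i \<in> S"
    show "ip k (trig_poly S c) (\<lambda>x. cis (of_int i * x)) = 0"
      using that(2)[OF \<open>i \<in> S\<close>] unfolding b_def by (simp add: ip_trig_poly_left[OF k that(1) continuous_on_cis_int])
  qed
  have "\<exists>!c. ?P c"
  proof (rule ex_ex1I)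
    obtain c where c: "\<forall>i\<in>?S. b n i + (\<Sum>j\<in>?S. c j * b j i) = 0"
      using nondegenerate_system_solvable[where b = b and S = ?S and h = "b n"] nd finite_tri by blast
    define c' where "c' j = (if tri j n then c j else 0)" for j
    have "(\<Sum>j\<in>?S. c' j * b j i) = (\<Sum>j\<in>?S. c j * b j i)" for i
      by (intro sum.cong) (auto simp: c'_def)
    with c have "?P c'" unfolding P by (auto simp: c'_def)
    then show "\<exists>c. ?P c" by blast
  next
    fix c d assume cd: "?P c" "?P d"
    have "c i - d i = 0" if "tri i n" for i
    proof (rule nd[of ?S "\<lambda>j. c j - d j"])
      fix i assume "i \<in> ?S"
      then have "b n i + (\<Sum>j\<in>?S. c j * b j i) = b n i + (\<Sum>j\<in>?S. d j * b j i)"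
        using cd unfolding P by simp
      then show "(\<Sum>j\<in>?S. (c j - d j) * b j i) = 0"
        by (simp add: left_diff_distrib sum_subtractf)
    qed (use that in auto)
    then show "c = d"
      using cd unfolding P by (metis eq_iff_diff_eq_0 ext)
  qed
  then have "?P (coefs k n)"
    unfolding coefs_def by (rule theI')
  then show ?thesis
    using assms(2) unfolding Epoly_eq_trig_poly exp_i_conv_cis by blast
qed

section \<open>The product formula\<close>

lemma gen_translation_trig_poly:
  assumes "k > 0" "\<bar>x\<bar> \<le> pi" "\<bar>y\<bar> \<le> pi" "sin x * sin y \<noteq> 0" "finite S"
  shows "gen_translation k y (trig_poly S c) x = (\<Sum>j\<in>S. c j * jacobi_mean k (shift_exp j x y))"
proof -
  have "gen_translation k y (trig_poly S c) x = integral {-pi..pi} (\<lambda>z. \<Sum>j\<in>S. c j *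
      (cis (of_int j * z) * calW k x y z * complex_of_real (\<bar>sin z\<bar> powr (2 * k))))"
    unfolding gen_translation_def trig_poly_def by (intro integral_cong) (simp add: sum_distrib_right mult.assoc)
  also have "\<dots> = (\<Sum>j\<in>S. integral {-pi..pi} (\<lambda>z. c j *
      (cis (of_int j * z) * calW k x y z * complex_of_real (\<bar>sin z\<bar> powr (2 * k)))))"
    by (intro integral_sum assms integrable_on_mult_right set_borel_integral_eq_integral(1)
        calW_set_integrable continuous_on_cis_int)
  also have "\<dots> = (\<Sum>j\<in>S. c j * gen_translation k y (\<lambda>z. cis (of_int j * z)) x)"
    unfolding gen_translation_def by (simp only: integral_mult_right)
  finally show ?thesis
    by (simp only: gen_translation_cis[OF assms(1-4)])
qed

text \<open>The weight is 0 where sin x = 0, so the artificial values of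
  \<open>gen_translation\<close> at those points do not affect inner products.\<close>

lemma ip_cong_sin:
  assumes "\<And>x. \<bar>x\<bar> \<le> pi \<Longrightarrow> sin x \<noteq> 0 \<Longrightarrow> f x = f' x \<and> g x = g' x"
  shows "ip k f g = ip k f' g'"
  unfolding ip_def
proof (rule integral_cong)
  fix x assume "x \<in> {-pi..pi}"
  then show "f x * cnj (g x) * complex_of_real (\<bar>sin x\<bar> powr (2 * k)) =
      f' x * cnj (g' x) * complex_of_real (\<bar>sin x\<bar> powr (2 * k))"
    using assms[of x] by (cases "sin x = 0") auto
qed

text \<open>Each mean lives on \<open>idx j\<close>, and \<open>idx j\<close> lies in
  \<open>idx n\<close> by transitivity; exchanging the two sums collects the coefficients.\<close>

lemma trig_poly_mean_expansion:
  assumes "k > 0"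
  obtains b where "\<And>x. (\<Sum>j\<in>idx n. c j * jacobi_mean k (shift_exp j x y)) = trig_poly (idx n) b x"
proof -
  have "\<forall>j. \<exists>a. \<forall>x. jacobi_mean k (shift_exp j x y) = (\<Sum>i\<in>idx j. a i * cis (of_int i * x))"
    by (intro allI, rule shift_exp_mean_expansion[OF assms]) blast
  from choice[OF this] obtain a
    where a: "\<And>j x. jacobi_mean k (shift_exp j x y) = (\<Sum>i\<in>idx j. a j i * cis (of_int i * x))"
    by blast
  have "(\<Sum>j\<in>idx n. c j * jacobi_mean k (shift_exp j x y)) =
      trig_poly (idx n) (\<lambda>i. \<Sum>j\<in>idx n. if i \<in> idx j then c j * a j i else 0) x" for x
  proof -
    have "(\<Sum>j\<in>idx n. c j * jacobi_mean k (shift_exp j x y)) =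
        (\<Sum>j\<in>idx n. \<Sum>i\<in>idx n. (if i \<in> idx j then c j * a j i else 0) * cis (of_int i * x))"
    proof (rule sum.cong)
      fix j assume "j \<in> idx n"
      then have "idx j \<subseteq> idx n"
        using idx_subset_tri[of j n] by (auto simp: idx_eq[of n])
      then show "c j * jacobi_mean k (shift_exp j x y) =
          (\<Sum>i\<in>idx n. (if i \<in> idx j then c j * a j i else 0) * cis (of_int i * x))"
        unfolding a sum_distrib_left by (intro sum.mono_neutral_cong_left) auto
    qed simp
    then show ?thesis
      unfolding trig_poly_def sum_distrib_right by (subst (asm) sum.swap)
  qed
  then show ?thesis by (rule that)
qed

text \<open>The product formula for E_n before normalization, cleared of the denominator
  \<open>E 0\<close>.\<close>

lemma gen_translation_Eop:
  fixes E :: "real \<Rightarrow> complex" and n :: int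
  assumes k: "k > 0" and x: "\<bar>x\<bar> \<le> pi" and y: "\<bar>y\<bar> \<le> pi" and nz: "sin x * sin y \<noteq> 0"
  defines "E \<equiv> \<lambda>x. Eop k n (\<i> * complex_of_real x)"
  shows "gen_translation k y E x * E 0 = E x * E y"
proof -
  define C where "C = (coefs k n)(n := 1)"
  have E: "E = trig_poly (idx n) C"
    unfolding E_def C_def Eop_def Epoly_eq_trig_poly ..
  have Cn: "C n = 1" by (simp add: C_def)
  have orth: "ip k E (\<lambda>x. cis (of_int i * x)) = 0" if "tri i n" for i
    using coefs_orthogonal[OF k that] unfolding E C_def .
  obtain b where b: "\<And>x. (\<Sum>j\<in>idx n. C j * jacobi_mean k (shift_exp j x y)) = trig_poly (idx n) b x"
    using trig_poly_mean_expansion[OF k] by blast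
  have gE: "gen_translation k y E x = trig_poly (idx n) b x" if "\<bar>x\<bar> \<le> pi" "sin x \<noteq> 0" for x
    unfolding E b[symmetric] using that y nz by (intro gen_translation_trig_poly k) auto
  \<comment> \<open>The adjoint sends e^(ixi), for a frequency i below n, into the span of
    \<open>idx i\<close>, all of whose frequencies are below n and so orthogonal to
    \<open>E\<close>.\<close>
  have orth': "ip k (trig_poly (idx n) b) (\<lambda>x. cis (of_int i * x)) = 0" if i: "tri i n" for i
  proof -
    obtain a where a: "\<And>x. jacobi_mean k (shift_exp i x (- y)) = trig_poly (idx i) a x"
      using shift_exp_mean_expansion[OF k, of i "- y"] unfolding trig_poly_def by blast
    have "ip k (trig_poly (idx n) b) (\<lambda>x. cis (of_int i * x)) = ip k (gen_translation k y E) (\<lambda>x. cis (of_int i * x))"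
      by (rule ip_cong_sin) (simp add: gE)
    also have "\<dots> = ip k E (gen_translation k (- y) (\<lambda>x. cis (of_int i * x)))"
      unfolding E using y nz by (intro gen_translation_adjoint k continuous_trig_poly continuous_on_cis_int) auto
    also have "\<dots> = ip k E (trig_poly (idx i) a)"
      unfolding a[symmetric] using y nz by (intro ip_cong_sin) (auto intro!: gen_translation_cis k)
    also have "\<dots> = (\<Sum>j\<in>idx i. cnj (a j) * ip k E (\<lambda>x. cis (of_int j * x)))"
      unfolding E by (intro ip_trig_poly_right k finite_idx continuous_trig_poly)
    also have "\<dots> = 0"
      using idx_subset_tri[OF i] orth by (intro sum.neutral) auto
    finally show ?thesis .
  qed
  \<comment> \<open>Subtracting b n times \<open>E\<close> removes the frequency n because
    \<open>C n = 1\<close>. The remainder is spanned by frequencies below n and orthogonal to them,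
    hence zero.\<close>
  define d where "d j = b j - b n * C j" for j
  have d: "trig_poly (idx n) b x = b n * E x + trig_poly {j. tri j n} d x" for x
  proof -
    have "trig_poly (idx n) b x = b n * E x + trig_poly (idx n) d x"
      unfolding E trig_poly_def sum_distrib_left sum.distrib[symmetric] d_def
      by (intro sum.cong) (auto simp: algebra_simps)
    also have "trig_poly (idx n) d x = trig_poly {j. tri j n} d x"
      unfolding trig_poly_def idx_eq by (subst sum.insert) (auto simp: tri_irrefl d_def Cn)
    finally show ?thesis .
  qed
  have "d i = 0" if "tri i n" for i
  proof (rule trig_poly_orthogonal_imp[OF k finite_tri])
    fix i assume "i \<in> {j. tri j n}"
    then have i: "tri i n" by simp
    let ?e = "\<lambda>x. cis (of_int i * x)"
    have e: "continuous_on UNIV ?e" by (rule continuous_on_cis_int)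
    have "(\<Sum>j\<in>idx n. d j * ip k (\<lambda>x. cis (of_int j * x)) ?e) =
        ip k (trig_poly (idx n) b) ?e - b n * ip k E ?e"
      unfolding E ip_trig_poly_left[OF k finite_idx e] sum_distrib_left sum_subtractf[symmetric] d_def
      by (intro sum.cong) (auto simp: algebra_simps)
    also have "\<dots> = 0" using orth[OF i] orth'[OF i] by simp
    also have "(\<Sum>j\<in>idx n. d j * ip k (\<lambda>x. cis (of_int j * x)) ?e) =
        (\<Sum>j\<in>{j. tri j n}. d j * ip k (\<lambda>x. cis (of_int j * x)) ?e)"
      unfolding idx_eq by (subst sum.insert) (auto simp: tri_irrefl d_def Cn)
    finally show "ip k (trig_poly {j. tri j n} d) ?e = 0"
      by (simp only: ip_trig_poly_left[OF k finite_tri e])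
  qed (use that in simp)
  then have bE: "trig_poly (idx n) b x = b n * E x" for x
    unfolding d by (simp add: trig_poly_def)
  \<comment> \<open>The factor is found at x = 0 from the expansion in \<open>jacobi_mean\<close>,
    not from \<open>gen_translation\<close>, whose value there is 0.\<close>
  have "b n * E 0 = (\<Sum>j\<in>idx n. C j * jacobi_mean k (shift_exp j 0 y))"
    unfolding bE[symmetric] b ..
  also have "\<dots> = E y"
    unfolding E trig_poly_def
  proof (intro sum.cong refl)
    fix j
    have "shift_exp j 0 y = (\<lambda>_. cis (of_int j * y))" by (simp add: fun_eq_iff shift_exp_0)
    then show "C j * jacobi_mean k (shift_exp j 0 y) = C j * cis (of_int j * y)"
      by (simp add: jacobi_mean_const[OF k])
  qed
  finally have "b n * E 0 = E y" .
  moreover have "gen_translation k y E x = b n * E x"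
    using gE[of x] bE x nz by simp
  ultimately show ?thesis by (simp add: mult_ac)
qed

text \<open>All frequencies in E_n have the parity of n, so a shift by an odd multiple of pi
  multiplies every term by (-1)^n.\<close>

lemma Eop_shift_pi:
  fixes m :: int
  shows "Eop k n (\<i> * complex_of_real (x + pi + 2 * pi * of_int m)) =
    (if even n then 1 else - 1) * Eop k n (\<i> * complex_of_real x)"
  unfolding Eop_def Epoly_eq_trig_poly trig_poly_def sum_distrib_left
proof (intro sum.cong refl)
  fix j assume "j \<in> idx n"
  then have par: "even j \<longleftrightarrow> even n"
    using idx_parity[of j n] by auto
  have "of_int j * (x + pi + 2 * pi * of_int m) = of_int j * x + (pi * of_int j + 2 * pi * of_int (j * m))"
    by (simp add: algebra_simps)
  then have "cis (of_int j * (x + pi + 2 * pi * of_int m)) = cis (of_int j * x) * (cis (pi * of_int j) * cis (2 * pi * of_int (j * m)))"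
    by (simp only: cis_mult)
  also have "cis (2 * pi * of_int (j * m)) = 1"
    by (rule cis_multiple_2pi) simp
  also have "cis (pi * of_int j) = (if even n then 1 else - 1)"
    unfolding par[symmetric] by (simp add: complex_eq_iff)
  finally show "((coefs k n)(n := 1)) j * cis (of_int j * (x + pi + 2 * pi * of_int m)) =
      (if even n then 1 else - 1) * (((coefs k n)(n := 1)) j * cis (of_int j * x))"
    by simp
qed

text \<open>When \<open>Eop k n 0\<close> is nonzero, normalization makes the factor at the odd
  multiple y of pi exactly (-1)^n, the same sign that the shift of x by an odd multiple of pi
  produces.\<close>

lemma calE_shift_pi:
  fixes m l :: int
  assumes "y = pi + 2 * pi * of_int l"
  shows "calE k n (\<i> * complex_of_real x) * calE k n (\<i> * complex_of_real y) =
    calE k n (\<i> * complex_of_real (x + pi + 2 * pi * of_int m))"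
  using Eop_shift_pi[of k n x m] Eop_shift_pi[of k n 0 l] by (simp add: assms calE_def)

text \<open>Integration against a Dirac mass is written as evaluation at the point. The quantifier
  over w covers the case where x + pi or y + pi is congruent to both pi and -pi.\<close>

theorem mainTheorem7:
  fixes k x y :: real and n :: int
  assumes "k > 0" and "x \<in> {-pi..pi}" and "y \<in> {-pi..pi}"
  shows "(sin x * sin y \<noteq> 0 \<longrightarrow>
            calE k n (\<i> * x) * calE k n (\<i> * y) =
            integral {-pi..pi} (\<lambda>z. calE k n (\<i> * z) * calW k x y z *
                                   complex_of_real (\<bar>sin z\<bar> powr (2 * k))))
       \<and> (y = 0 \<longrightarrow> calE k n (\<i> * x) * calE k n (\<i> * y) = calE k n (\<i> * x))
       \<and> (x = 0 \<longrightarrow> calE k n (\<i> * x) * calE k n (\<i> * y) = calE k n (\<i> * y))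
       \<and> ((y = pi \<or> y = - pi) \<longrightarrow> (\<forall>w \<in> {-pi..pi}. (\<exists>m::int. w = x + pi + 2 * pi * m) \<longrightarrow>
            calE k n (\<i> * x) * calE k n (\<i> * y) = calE k n (\<i> * w)))
       \<and> ((x = pi \<or> x = - pi) \<longrightarrow> (\<forall>w \<in> {-pi..pi}. (\<exists>m::int. w = y + pi + 2 * pi * m) \<longrightarrow>
            calE k n (\<i> * x) * calE k n (\<i> * y) = calE k n (\<i> * w)))"
proof (intro conjI impI ballI; (elim exE)?)
  define E where "E x = Eop k n (\<i> * complex_of_real x)" for x
  have calE: "calE k n (\<i> * complex_of_real x) = E x / E 0" for x
    by (simp add: calE_def E_def)
  assume nz: "sin x * sin y \<noteq> 0"
  have "integral {-pi..pi} (\<lambda>z. calE k n (\<i> * z) * calW k x y z * complex_of_real (\<bar>sin z\<bar> powr (2 * k)))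
      = integral {-pi..pi} (\<lambda>z. E z * calW k x y z * complex_of_real (\<bar>sin z\<bar> powr (2 * k)) / E 0)"
    by (simp add: calE)
  also have "\<dots> = gen_translation k y E x / E 0"
    unfolding gen_translation_def by (rule integral_divide)
  also have "\<dots> = E x / E 0 * (E y / E 0)"
    using gen_translation_Eop[OF assms(1) _ _ nz, of n] assms
    \<comment> \<open>if \<open>E 0 = 0\<close>, division by zero makes both sides vanish\<close>
    by (cases "E 0 = 0") (auto simp: E_def[abs_def] field_simps abs_le_iff)
  finally show "calE k n (\<i> * x) * calE k n (\<i> * y) =
      integral {-pi..pi} (\<lambda>z. calE k n (\<i> * z) * calW k x y z * complex_of_real (\<bar>sin z\<bar> powr (2 * k)))"
    by (simp add: calE)
next
  assume "y = 0"
  then show "calE k n (\<i> * x) * calE k n (\<i> * y) = calE k n (\<i> * x)"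
    by (simp add: calE_def)
next
  assume "x = 0"
  then show "calE k n (\<i> * x) * calE k n (\<i> * y) = calE k n (\<i> * y)"
    by (simp add: calE_def)
next
  fix w m assume y: "y = pi \<or> y = - pi" and w: "w = x + pi + 2 * pi * of_int m"
  show "calE k n (\<i> * x) * calE k n (\<i> * y) = calE k n (\<i> * w)"
    \<comment> \<open>The odd multiple pi + 2 pi l is pi for l = 0 and -pi for l = -1.\<close>
    using y calE_shift_pi[of y 0] calE_shift_pi[of y "-1"] unfolding w by auto
next
  fix w m assume x: "x = pi \<or> x = - pi" and w: "w = y + pi + 2 * pi * of_int m"
  show "calE k n (\<i> * x) * calE k n (\<i> * y) = calE k n (\<i> * w)"
    using x calE_shift_pi[of x 0 k n y m] calE_shift_pi[of x "-1" k n y m] unfolding w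
    by (auto simp: mult.commute)
qed

end
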